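(* Let $X$ be a $JB^*$-triple. Any very smooth point of $X$ is a Fréchet smooth point of $X$.
   Context: A $JB^*$-triple is a complex Banach space $X$ with a continuous triple product $\{\cdot,\cdot,\cdot\} : X^3 \to X$ that is linear and symmetric in the outer variables and conjugate linear in the middle variable, such that, writing $D(a,b)x = \{a,b,x\}$: (i) $D(a,b)\{x,y,z\} = \{D(a,b)x,y,z\} - \{x,D(b,a)y,z\} + \{x,y,D(a,b)z\}$ for all $a,b,x,y,z \in X$; (ii) for each $a \in X$ the operator $D(a,a)$ is hermitian with nonnegative spectrum; (iii) $\|\{a,a,a\}\| = \|a\|^3$ for all $a \in X$. A unit vector $x$ of a Banach space $Z$ is a smooth point of $Z$ if there is exactly one $z^* \in Z^*$ with $\|z^*\| = 1 = z^*(x)$. A unit vector $x \in Z$ is a very smooth point of $Z$ if, regarded as an element of $Z^{**}$ under the canonical embedding $Z \subset Z^{**}$, it is a smooth point of $Z^{**}$. A unit vector $x \in Z$ is a Fréchet smooth point if the norm of $Z$ is Fréchet differentiable at $x$. *)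

theory Defs
  imports "HOL-Analysis.Analysis"
begin

section \<open>Complex normed spaces\<close>

class scaleC =
  fixes scaleC :: "complex \<Rightarrow> 'a \<Rightarrow> 'a" (infixr "*\<^sub>C" 75)

class complex_normed_vector = real_normed_vector + scaleC +
  assumes scaleC_add_right: "c *\<^sub>C (x + y) = c *\<^sub>C x + c *\<^sub>C y"
    and scaleC_add_left: "(c + d) *\<^sub>C x = c *\<^sub>C x + d *\<^sub>C x"
    and scaleC_scaleC: "c *\<^sub>C d *\<^sub>C x = (c * d) *\<^sub>C x"
    and scaleC_one: "1 *\<^sub>C x = x"
    and scaleR_scaleC: "r *\<^sub>R x = complex_of_real r *\<^sub>C x"
    and norm_scaleC: "norm (c *\<^sub>C x) = cmod c * norm x"

class complex_banach = complex_normed_vector + banach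

instantiation complex :: complex_banach
begin

definition scaleC_complex :: "complex \<Rightarrow> complex \<Rightarrow> complex"
  where "scaleC_complex c x = c * x"

instance
  by standard (simp_all add: scaleC_complex_def algebra_simps norm_mult scaleR_conv_of_real)

end

definition bounded_clinear :: "('a::complex_normed_vector \<Rightarrow> 'b::complex_normed_vector) \<Rightarrow> bool"
  where "bounded_clinear f \<longleftrightarrow> bounded_linear f \<and> (\<forall>c x. f (c *\<^sub>C x) = c *\<^sub>C f x)"


section \<open>The dual space and the canonical embedding into the bidual\<close>

typedef (overloaded) 'a cdual = "{f :: 'a::complex_normed_vector \<Rightarrow> complex. bounded_clinear f}"
  morphisms cdual_apply Abs_cdual
  by (rule exI[of _ "\<lambda>_. 0"])
    (simp add: bounded_clinear_def scaleC_complex_def bounded_linear_zero)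

setup_lifting type_definition_cdual

lemma cdual_eqI: "(\<And>x. cdual_apply f x = cdual_apply g x) \<Longrightarrow> f = g"
  by (simp add: cdual_apply_inject[symmetric] fun_eq_iff)

lemma bounded_clinear_cdual_apply: "bounded_clinear (cdual_apply f)"
  using cdual_apply[of f] by simp

lemma bounded_linear_cdual_apply: "bounded_linear (cdual_apply f)"
  using bounded_clinear_cdual_apply[of f] by (simp add: bounded_clinear_def)

instantiation cdual :: (complex_normed_vector) complex_normed_vector
begin

lift_definition norm_cdual :: "'a cdual \<Rightarrow> real" is onorm .

lift_definition zero_cdual :: "'a cdual" is "\<lambda>_. 0"
  by (simp add: bounded_clinear_def scaleC_complex_def bounded_linear_zero)

lift_definition plus_cdual :: "'a cdual \<Rightarrow> 'a cdual \<Rightarrow> 'a cdual" is "\<lambda>f g x. f x + g x"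
  by (auto simp: bounded_clinear_def scaleC_complex_def algebra_simps intro: bounded_linear_add)

lift_definition minus_cdual :: "'a cdual \<Rightarrow> 'a cdual \<Rightarrow> 'a cdual" is "\<lambda>f g x. f x - g x"
  by (auto simp: bounded_clinear_def scaleC_complex_def algebra_simps intro: bounded_linear_sub)

lift_definition uminus_cdual :: "'a cdual \<Rightarrow> 'a cdual" is "\<lambda>f x. - f x"
  by (auto simp: bounded_clinear_def scaleC_complex_def intro: bounded_linear_minus)

lift_definition scaleC_cdual :: "complex \<Rightarrow> 'a cdual \<Rightarrow> 'a cdual" is "\<lambda>c f x. c * f x"
  by (auto simp: bounded_clinear_def scaleC_complex_def intro: bounded_linear_const_mult)

definition scaleR_cdual :: "real \<Rightarrow> 'a cdual \<Rightarrow> 'a cdual"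
  where "scaleR_cdual r f = complex_of_real r *\<^sub>C f"

definition dist_cdual :: "'a cdual \<Rightarrow> 'a cdual \<Rightarrow> real"
  where "dist_cdual f g = norm (f - g)"

definition sgn_cdual :: "'a cdual \<Rightarrow> 'a cdual"
  where "sgn_cdual f = scaleR (inverse (norm f)) f"

definition [code del]: "(uniformity :: ('a cdual \<times> 'a cdual) filter) =
  (INF e\<in>{0<..}. principal {(f, g). dist f g < e})"

definition open_cdual :: "'a cdual set \<Rightarrow> bool"
  where [code del]: "open_cdual U \<longleftrightarrow> (\<forall>f\<in>U. \<forall>\<^sub>F (f', g) in uniformity. f' = f \<longrightarrow> g \<in> U)"

instance
proof
  note rep_eqs = zero_cdual.rep_eq plus_cdual.rep_eq minus_cdual.rep_eq uminus_cdual.rep_eq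
    scaleC_cdual.rep_eq
  fix f g h :: "'a cdual" and r s :: real and c d :: complex and U :: "'a cdual set"
  show "f + g + h = f + (g + h)" "f + g = g + f" "0 + f = f" "- f + f = 0" "f - g = f + - g"
    by (rule cdual_eqI, simp add: rep_eqs)+
  show C1: "c *\<^sub>C (f + g) = c *\<^sub>C f + c *\<^sub>C g" "(c + d) *\<^sub>C f = c *\<^sub>C f + d *\<^sub>C f"
    "c *\<^sub>C d *\<^sub>C f = (c * d) *\<^sub>C f" "1 *\<^sub>C f = f"
    for c d and f g :: "'a cdual"
    by (rule cdual_eqI, simp add: rep_eqs algebra_simps)+
  show "r *\<^sub>R (f + g) = r *\<^sub>R f + r *\<^sub>R g" "(r + s) *\<^sub>R f = r *\<^sub>R f + s *\<^sub>R f"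
    "r *\<^sub>R s *\<^sub>R f = (r * s) *\<^sub>R f" "1 *\<^sub>R f = f"
    by (simp_all add: scaleR_cdual_def C1)
  show "r *\<^sub>R f = complex_of_real r *\<^sub>C f"
    by (simp add: scaleR_cdual_def)
  show "dist f g = norm (f - g)" "sgn f = scaleR (inverse (norm f)) f"
    by (simp_all add: dist_cdual_def sgn_cdual_def)
  show "(uniformity :: ('a cdual \<times> 'a cdual) filter) = (INF e\<in>{0<..}. principal {(f, g). dist f g < e})"
    by (rule uniformity_cdual_def)
  show "open U \<longleftrightarrow> (\<forall>f\<in>U. \<forall>\<^sub>F (f', g) in uniformity. f' = f \<longrightarrow> g \<in> U)"
    by (rule open_cdual_def)
  show "norm f = 0 \<longleftrightarrow> f = 0"
    by transfer (auto simp: bounded_clinear_def onorm_eq_0)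
  show "norm (f + g) \<le> norm f + norm g"
    by transfer (auto simp: bounded_clinear_def intro: onorm_triangle)
  have le: "norm (c *\<^sub>C f) \<le> cmod c * norm f" for c and f :: "'a cdual"
  proof (transfer fixing: c)
    fix f :: "'a \<Rightarrow> complex" assume "bounded_clinear f"
    then have f: "bounded_linear f" by (simp add: bounded_clinear_def)
    show "onorm (\<lambda>x. c * f x) \<le> cmod c * onorm f"
    proof (rule onorm_bound)
      show "norm (c * f x) \<le> cmod c * onorm f * norm x" for x
        using mult_left_mono[OF onorm[OF f, of x], of "cmod c"] by (simp add: norm_mult mult.assoc)
    qed (simp add: onorm_pos_le[OF f])
  qed
  show nC: "norm (c *\<^sub>C f) = cmod c * norm f" for c and f :: "'a cdual"
  proof (cases "c = 0")
    case True
    have "(0 :: complex) *\<^sub>C f = 0" by transfer simp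
    moreover have "norm (0 :: 'a cdual) = 0" by transfer (simp add: onorm_zero)
    ultimately show ?thesis using True by simp
  next
    case False
    then have "inverse c *\<^sub>C c *\<^sub>C f = f" by (simp add: C1)
    with le[of "inverse c" "c *\<^sub>C f"]
    have "norm f \<le> cmod (inverse c) * norm (c *\<^sub>C f)" by simp
    then have "cmod c * norm f \<le> norm (c *\<^sub>C f)"
      using False by (simp add: norm_inverse norm_divide field_simps)
    with le[of c f] show ?thesis by simp
  qed
  show "norm (r *\<^sub>R f) = \<bar>r\<bar> * norm f"
    by (simp add: scaleR_cdual_def nC)
qed

end

lift_definition bidual_embed :: "'a::complex_normed_vector \<Rightarrow> 'a cdual cdual"
  is "\<lambda>x f. cdual_apply f x"
proof -
  fix x :: 'a
  have "bounded_linear (\<lambda>f. cdual_apply f x)"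
  proof (rule bounded_linear_intro)
    show "cdual_apply (f + g) x = cdual_apply f x + cdual_apply g x" for f g
      by (simp add: plus_cdual.rep_eq)
    show "cdual_apply (r *\<^sub>R f) x = r *\<^sub>R cdual_apply f x" for r f
      by (simp add: scaleR_cdual_def scaleC_cdual.rep_eq scaleR_conv_of_real)
    show "norm (cdual_apply f x) \<le> norm f * norm x" for f
      by (simp add: norm_cdual.rep_eq onorm bounded_linear_cdual_apply)
  qed
  then show "bounded_clinear (\<lambda>f. cdual_apply f x)"
    by (simp add: bounded_clinear_def scaleC_cdual.rep_eq scaleC_complex_def)
qed


section \<open>Smoothness\<close>

definition smooth_point :: "'a::complex_normed_vector \<Rightarrow> bool"
  where "smooth_point x \<longleftrightarrow> norm x = 1 \<and> (\<exists>!f :: 'a cdual. norm f = 1 \<and> cdual_apply f x = 1)"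

definition very_smooth_point :: "'a::complex_normed_vector \<Rightarrow> bool"
  where "very_smooth_point x \<longleftrightarrow> norm x = 1 \<and> smooth_point (bidual_embed x)"

definition frechet_smooth_point :: "'a::complex_normed_vector \<Rightarrow> bool"
  where "frechet_smooth_point x \<longleftrightarrow> norm x = 1 \<and> (norm :: 'a \<Rightarrow> real) differentiable (at x)"


section \<open>Hermitian operators and spectrum\<close>

text \<open>For bounded \<open>T\<close> the exponential series converges in operator norm, so its sum can be
  computed pointwise.\<close>

definition op_exp :: "('a::complex_banach \<Rightarrow> 'a) \<Rightarrow> 'a \<Rightarrow> 'a"
  where "op_exp T x = (\<Sum>n. (T ^^ n) x /\<^sub>R fact n)"

text \<open>\<open>T\<close> is hermitian if \<open>exp (i r T)\<close> is an isometry for every real \<open>r\<close>. As \<open>exp (- i r T)\<close> is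
  the inverse of \<open>exp (i r T)\<close>, this amounts to the operator norms all being \<open>1\<close>, except
  that it also covers the zero space.\<close>

definition hermitian_op :: "('a::complex_banach \<Rightarrow> 'a) \<Rightarrow> bool"
  where "hermitian_op T \<longleftrightarrow> bounded_clinear T \<and>
    (\<forall>r::real. \<forall>x. norm (op_exp (\<lambda>y. (\<i> * complex_of_real r) *\<^sub>C T y) x) = norm x)"

definition op_spectrum :: "('a::complex_banach \<Rightarrow> 'a) \<Rightarrow> complex set"
  where "op_spectrum T = {z. \<not> (\<exists>S. bounded_clinear S \<and>
    (\<forall>x. S (T x - z *\<^sub>C x) = x) \<and> (\<forall>x. T (S x) - z *\<^sub>C S x = x))}"


section \<open>JB*-triples\<close>

locale jb_star_triple =
  fixes triple :: "'a::complex_banach \<Rightarrow> 'a \<Rightarrow> 'a \<Rightarrow> 'a"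
  assumes continuous: "continuous_on UNIV (\<lambda>(a, b, c). triple a b c)"
    and symmetric: "triple a b c = triple c b a"
    and add_left: "triple (a + a') b c = triple a b c + triple a' b c"
    and scaleC_left: "triple (k *\<^sub>C a) b c = k *\<^sub>C triple a b c"
    and add_middle: "triple a (b + b') c = triple a b c + triple a b' c"
    and scaleC_middle: "triple a (k *\<^sub>C b) c = cnj k *\<^sub>C triple a b c"
    and jordan_identity: "triple a b (triple x y z) =
      triple (triple a b x) y z - triple x (triple b a y) z + triple x y (triple a b z)"
    and hermitian: "hermitian_op (triple a a)"
    and spectrum_nonneg: "op_spectrum (triple a a) \<subseteq> complex_of_real ` {0..}"
    and norm_cube: "norm (triple a a a) = norm a ^ 3"

end

theory Submission
  imports Defs "HOL-Complex_Analysis.Cauchy_Integral_Formula"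
    "HOL-Computational_Algebra.Fundamental_Theorem_Algebra"
begin

text \<open>
  Write \<open>x\<^bsup>(2n+1)\<^esup>\<close> for the odd powers of the unit vector \<open>x\<close>. The triple generated by \<open>x\<close> looks like
  continuous functions on a set \<open>S \<subseteq> [0, 1]\<close> containing \<open>1\<close>, with \<open>x\<close> as the identity function
  and its powers as \<open>s \<mapsto> s\<^bsup>2n+1\<^esup>\<close>. What makes this precise is the upper bound
  \<open>\<parallel>q(x)\<parallel> \<le> sup {\<bar>q(s)\<bar> | s \<in> [0, 1]}\<close> for odd real polynomials \<open>q\<close> (lemma \<open>N_le\<close>). It comes
  from \<open>\<parallel>{a, a, a}\<parallel> = \<parallel>a\<parallel>\<^sup>3\<close>, which turns norms into growth rates of powers, and from the
  nonnegative spectrum of \<open>D(x, x)\<close>, which controls these growth rates.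

  Very smoothness says that functionals in the unit ball which almost attain the norm at \<open>x\<close>
  converge weakly to the support functional of \<open>x\<close>. If \<open>1\<close> were not isolated in \<open>S\<close>, functionals
  resembling evaluations at points of \<open>S\<close> tending to \<open>1\<close> would violate this, because the powers
  of \<open>x\<close> accumulate in the bidual at something like the indicator function of \<open>1\<close>. Hence
  \<open>1\<close> is isolated, the odd powers of \<open>x\<close> converge in norm to a tripotent \<open>e\<close> (lemma
  \<open>powers_convergent\<close>), and \<open>x = e + w\<close> with \<open>w\<close> orthogonal to \<open>e\<close> and \<open>\<parallel>w\<parallel> < 1\<close>.

  Every support functional of \<open>e\<close> is one of \<open>x\<close>, so \<open>e\<close> has only one and the norm is Gateaux
  differentiable at \<open>e\<close>. The cube map fixes \<open>e\<close>, and \<open>\<parallel>{e + h, e + h, e + h}\<parallel> = \<parallel>e + h\<parallel>\<^sup>3\<close>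
  compares the cube of the norm at \<open>e + h\<close> with the norm at \<open>e + \<Lambda>h\<close>, up to an error of second
  order in \<open>h\<close>, where \<open>\<Lambda>\<close> is the derivative of the cube map at \<open>e\<close>. On the Peirce components of \<open>e\<close> the real
  operator \<open>\<Lambda>\<close> has eigenvalues \<open>0\<close>, \<open>1\<close> and \<open>3\<close>. For \<open>0\<close> and \<open>1\<close> the cube identity alone gives
  \<open>\<parallel>e + h\<parallel> \<le> 1 + O(\<parallel>h\<parallel>\<^sup>2)\<close>; for \<open>3\<close> it propagates the differential quotient from infinitesimal
  scales to scale \<open>1\<close> with a quadratic error, which makes the Gateaux derivative uniform
  (lemma \<open>quadratic_smoothness\<close>). Finally \<open>x\<close> is a convex combination
  of \<open>e\<close> and a point of the unit ball, and so inherits the estimate.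
\<close>

section \<open>The Hahn-Banach theorem and complex functionals\<close>

definition sublinear :: "('v::real_vector \<Rightarrow> real) \<Rightarrow> bool"
  where "sublinear p \<longleftrightarrow> (\<forall>u v. p (u + v) \<le> p u + p v) \<and> (\<forall>r v. r \<ge> 0 \<longrightarrow> p (r *\<^sub>R v) = r * p v)"

lemma sublinearI:
  assumes "\<And>u v. p (u + v) \<le> p u + p v" "\<And>r v. r > 0 \<Longrightarrow> p (r *\<^sub>R v) \<le> r * p v" "p 0 = 0"
  shows "sublinear p"
  unfolding sublinear_def
proof (intro conjI allI impI)
  fix r :: real and v assume "r \<ge> 0"
  show "p (r *\<^sub>R v) = r * p v"
  proof (cases "r = 0")
    case False
    then have "r > 0" using \<open>r \<ge> 0\<close> by simp
    have "p (inverse r *\<^sub>R r *\<^sub>R v) \<le> inverse r * p (r *\<^sub>R v)"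
      using \<open>r > 0\<close> by (intro assms(2)) simp
    then have "r * p v \<le> p (r *\<^sub>R v)" using \<open>r > 0\<close> by (simp add: field_simps)
    with assms(2)[OF \<open>r > 0\<close>, of v] show ?thesis by simp
  qed (use assms(3) in simp)
qed (use assms(1) in auto)

lemma sublinear_add: "sublinear p \<Longrightarrow> p (u + v) \<le> p u + p v"
  and sublinear_scale: "sublinear p \<Longrightarrow> r \<ge> 0 \<Longrightarrow> p (r *\<^sub>R v) = r * p v"
  by (auto simp: sublinear_def)

lemma sublinear_0: "sublinear p \<Longrightarrow> p 0 = 0"
  using sublinear_scale[of p 0 0] by simp

lemma sublinear_minus: "sublinear p \<Longrightarrow> - p (- v) \<le> p v"
  using sublinear_add[of p v "- v"] sublinear_0[of p] by simp

lemma sublinear_norm: "sublinear (norm :: 'v::real_normed_vector \<Rightarrow> real)"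
  by (rule sublinearI) (auto simp: norm_triangle_ineq)

text \<open>
  The quotient \<open>(p (w + v / t) - p w) / (1 / t)\<close> decreases as \<open>t\<close> grows, so this infimum is the
  one-sided directional derivative of \<open>p\<close> at \<open>w\<close> in the direction \<open>v\<close>.
\<close>

definition directional :: "('v::real_vector \<Rightarrow> real) \<Rightarrow> 'v \<Rightarrow> 'v \<Rightarrow> real"
  where "directional p w v = (INF t\<in>{0..}. p (v + t *\<^sub>R w) - t * p w)"

lemma directional_lower:
  assumes "sublinear p" "t \<ge> 0"
  shows "- p (- v) \<le> p (v + t *\<^sub>R w) - t * p w"
  using sublinear_add[OF assms(1), of "v + t *\<^sub>R w" "- v"] sublinear_scale[OF assms, of w] by simp

lemma directional_bdd: "sublinear p \<Longrightarrow> bdd_below ((\<lambda>t. p (v + t *\<^sub>R w) - t * p w) ` {0..})"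
  by (rule bdd_belowI2[where m = "- p (- v)"]) (use directional_lower in force)

lemma directional_le:
  assumes "sublinear p" "t \<ge> 0"
  shows "directional p w v \<le> p (v + t *\<^sub>R w) - t * p w"
  unfolding directional_def using assms by (intro cINF_lower directional_bdd) auto

lemma directional_approx:
  assumes "sublinear p" "directional p w v < a"
  obtains t where "t \<ge> 0" "p (v + t *\<^sub>R w) - t * p w < a"
proof -
  have "\<exists>y\<in>(\<lambda>t. p (v + t *\<^sub>R w) - t * p w) ` {0..}. y < a"
    using assms(2) directional_bdd[OF assms(1)] unfolding directional_def
    by (subst (asm) cInf_less_iff) auto
  then show ?thesis using that by auto
qed

lemma directional_self: "sublinear p \<Longrightarrow> directional p w (- w) \<le> - p w"
  using directional_le[of p 1 w "- w"] sublinear_0[of p] by simp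

lemma directional_sublinear:
  assumes p: "sublinear p"
  shows "sublinear (directional p w)"
proof (rule sublinearI)
  fix u v
  show "directional p w (u + v) \<le> directional p w u + directional p w v"
  proof (rule field_le_epsilon)
    fix e :: real assume "e > 0"
    obtain s where s: "s \<ge> 0" "p (u + s *\<^sub>R w) - s * p w < directional p w u + e/2"
      using directional_approx[OF p, of w u "directional p w u + e/2"] \<open>e > 0\<close> by auto
    obtain t where t: "t \<ge> 0" "p (v + t *\<^sub>R w) - t * p w < directional p w v + e/2"
      using directional_approx[OF p, of w v "directional p w v + e/2"] \<open>e > 0\<close> by auto
    have "directional p w (u + v) \<le> p (u + v + (s + t) *\<^sub>R w) - (s + t) * p w"
      using s t by (intro directional_le[OF p]) auto
    also have "\<dots> \<le> (p (u + s *\<^sub>R w) - s * p w) + (p (v + t *\<^sub>R w) - t * p w)"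
      using sublinear_add[OF p, of "u + s *\<^sub>R w" "v + t *\<^sub>R w"] by (simp add: algebra_simps)
    finally show "directional p w (u + v) \<le> directional p w u + directional p w v + e"
      using s t by simp
  qed
next
  fix r :: real and v assume r: "r > 0"
  show "directional p w (r *\<^sub>R v) \<le> r * directional p w v"
  proof (rule field_le_epsilon)
    fix e :: real assume "e > 0"
    obtain t where t: "t \<ge> 0" "p (v + t *\<^sub>R w) - t * p w < directional p w v + e/r"
      using directional_approx[OF p, of w v "directional p w v + e/r"] \<open>e > 0\<close> r by auto
    have "directional p w (r *\<^sub>R v) \<le> p (r *\<^sub>R v + (r * t) *\<^sub>R w) - (r * t) * p w"
      using t r by (intro directional_le[OF p]) auto
    also have "\<dots> = r * (p (v + t *\<^sub>R w) - t * p w)"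
      using r sublinear_scale[OF p, of r "v + t *\<^sub>R w"] by (simp add: scaleR_add_right right_diff_distrib)
    also have "\<dots> \<le> r * (directional p w v + e/r)" using t r by (intro mult_left_mono) auto
    finally show "directional p w (r *\<^sub>R v) \<le> r * directional p w v + e"
      using r by (simp add: algebra_simps)
  qed
next
  have "(\<lambda>t. p (0 + t *\<^sub>R w) - t * p w) ` {0..} = (\<lambda>t. 0) ` {0::real..}"
    by (intro image_cong) (auto simp: sublinear_scale[OF p])
  then show "directional p w 0 = 0" unfolding directional_def by (simp add: image_constant_conv)
qed

text \<open>
  By Zorn's lemma there is a minimal sublinear functional below \<open>p\<close>. Its directional derivatives
  are sublinear and lie below it, so they coincide with it, and this forces linearity.
\<close>

theorem Hahn_Banach:
  assumes p: "sublinear p"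
  obtains g where "linear g" "\<And>v. g v \<le> p v"
proof -
  define A where "A = {q. sublinear q \<and> q \<le> p}"
  have "\<exists>m\<in>A. \<forall>a\<in>A. m \<ge> a \<longrightarrow> a = m"
  proof (rule predicate_Zorn)
    show "partial_order_on A (relation_of (\<ge>) A)"
      by (auto simp: partial_order_on_def preorder_on_def refl_on_def trans_def antisym_def relation_of_def)
  next
    fix C assume C: "C \<in> Chains (relation_of (\<ge>) A)"
    then have CA: "C \<subseteq> A" by (auto simp: Chains_def relation_of_def)
    have tot: "q \<le> q' \<or> q' \<le> q" if "q \<in> C" "q' \<in> C" for q q'
      using C that unfolding Chains_def relation_of_def by auto
    show "\<exists>u\<in>A. \<forall>a\<in>C. a \<ge> u"
    proof (cases "C = {}")
      case True
      then show ?thesis using p by (auto simp: A_def)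
    next
      case False
      define u where "u v = (INF q\<in>C. q v)" for v
      have low: "- p (- v) \<le> q v" if "q \<in> C" for q v
      proof -
        have "sublinear q" "q (- v) \<le> p (- v)" using that CA by (auto simp: A_def le_fun_def)
        then show ?thesis using sublinear_minus[of q v] by simp
      qed
      have bdd: "bdd_below ((\<lambda>q. q v) ` C)" for v
        by (rule bdd_belowI2[where m = "- p (- v)"]) (rule low)
      have uq: "u v \<le> q v" if "q \<in> C" for q v
        unfolding u_def using bdd that by (rule cINF_lower)
      have ex: "\<exists>q\<in>C. q v < a" if "u v < a" for v a
        using that bdd False unfolding u_def by (subst (asm) cINF_less_iff) auto
      have "sublinear u"
      proof (rule sublinearI)
        fix v w
        show "u (v + w) \<le> u v + u w"
        proof (rule field_le_epsilon)
          fix e :: real assume "e > 0"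
          obtain q where q: "q \<in> C" "q v < u v + e/2" using ex[of v "u v + e/2"] \<open>e > 0\<close> by auto
          obtain q' where q': "q' \<in> C" "q' w < u w + e/2" using ex[of w "u w + e/2"] \<open>e > 0\<close> by auto
          obtain r where r: "r \<in> C" "r \<le> q" "r \<le> q'"
            using tot[OF q(1) q'(1)] q q' by (metis order_refl)
          have "u (v + w) \<le> r (v + w)" using r uq by simp
          also have "\<dots> \<le> r v + r w" using r CA by (intro sublinear_add) (auto simp: A_def)
          also have "\<dots> \<le> q v + q' w" using r by (auto simp: le_fun_def intro: add_mono)
          finally show "u (v + w) \<le> u v + u w + e" using q q' by simp
        qed
      next
        fix s :: real and v assume s: "s > 0"
        show "u (s *\<^sub>R v) \<le> s * u v"
        proof (rule field_le_epsilon)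
          fix e :: real assume "e > 0"
          obtain q where q: "q \<in> C" "q v < u v + e/s" using ex[of v "u v + e/s"] \<open>e > 0\<close> s by auto
          have "u (s *\<^sub>R v) \<le> s * q v"
            using uq[OF q(1), of "s *\<^sub>R v"] sublinear_scale[of q s v] q CA s by (auto simp: A_def)
          also have "\<dots> \<le> s * (u v + e/s)" using q s by (intro mult_left_mono) auto
          finally show "u (s *\<^sub>R v) \<le> s * u v + e" using s by (simp add: algebra_simps)
        qed
      next
        have "(\<lambda>q. q 0) ` C = (\<lambda>q. 0) ` C"
          using CA by (intro image_cong) (auto simp: A_def sublinear_0)
        then show "u 0 = 0" unfolding u_def using False by (simp add: image_constant_conv)
      qed
      moreover have "u \<le> p"
      proof (rule le_funI)
        fix v
        obtain q where "q \<in> C" using False by auto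
        then show "u v \<le> p v" using uq[of q v] CA by (auto simp: A_def le_fun_def intro: order_trans)
      qed
      ultimately show ?thesis using uq by (auto simp: A_def le_fun_def)
    qed
  qed
  then obtain m where m: "sublinear m" "m \<le> p" and min: "\<And>a. sublinear a \<Longrightarrow> a \<le> m \<Longrightarrow> a = m"
    unfolding A_def by (auto intro: order_trans)
  \<comment> \<open>the derivative at \<open>w\<close> is at most \<open>- m w\<close> in the direction \<open>- w\<close>, so \<open>m\<close> is odd\<close>
  have odd: "m (- w) = - m w" for w
  proof -
    have "directional m w \<le> m"
      using directional_le[OF m(1), of 0 w] by (auto simp: le_fun_def)
    then have "directional m w = m" using min directional_sublinear[OF m(1)] by blast
    then have "m (- w) \<le> - m w" using directional_self[OF m(1), of w] by simp
    then show ?thesis using sublinear_minus[OF m(1), of w] by simp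
  qed
  have "linear m"
  proof (rule linearI)
    fix u v
    have "m u + m v \<le> m (u + v)"
      using sublinear_add[OF m(1), of "- u" "- v"] odd[of "u + v"] odd[of u] odd[of v] by simp
    then show "m (u + v) = m u + m v" using sublinear_add[OF m(1), of u v] by simp
  next
    fix r :: real and v
    show "m (r *\<^sub>R v) = r *\<^sub>R m v"
    proof (cases "r \<ge> 0")
      case False
      then show ?thesis using sublinear_scale[OF m(1), of "- r" v] odd[of "r *\<^sub>R v"] by simp
    qed (simp add: sublinear_scale[OF m(1)])
  qed
  then show ?thesis using m(2) that by (auto simp: le_fun_def)
qed

text \<open>
  A linear functional below the directional derivative of \<open>p\<close> at \<open>w\<close> touches \<open>p\<close> at \<open>w\<close>.
\<close>

corollary Hahn_Banach_touching:
  assumes p: "sublinear p"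
  obtains g where "linear g" "\<And>v. g v \<le> p v" "g w = p w"
proof -
  obtain g where g: "linear g" "\<And>v. g v \<le> directional p w v"
    using Hahn_Banach[OF directional_sublinear[OF p]] by blast
  have le: "g v \<le> p v" for v
    using g(2)[of v] directional_le[OF p, of 0 w v] by simp
  have "- g w \<le> - p w"
    using g(2)[of "- w"] directional_self[OF p, of w] linear_neg[OF g(1), of w] by simp
  with le[of w] show ?thesis using that[OF g(1) le] by simp
qed

lemma scaleR_scaleC_commute:
  fixes v :: "'a::complex_normed_vector"
  shows "c *\<^sub>C (r *\<^sub>R v) = r *\<^sub>R (c *\<^sub>C v)"
  by (simp add: scaleR_scaleC scaleC_scaleC mult.commute)

lemma scaleC_minus_right: "c *\<^sub>C (- v) = - (c *\<^sub>C (v::'a::complex_normed_vector))"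
  using scaleC_add_right[of c v "- v"] scaleC_add_right[of c 0 0]
  by (metis add.right_inverse add_cancel_right_left minus_unique)

lemma scaleC_diff_right: "c *\<^sub>C (u - v) = c *\<^sub>C u - c *\<^sub>C (v::'a::complex_normed_vector)"
  using scaleC_add_right[of c u "- v"] by (simp add: scaleC_minus_right)

lemma cdual_bound: "cmod (cdual_apply f v) \<le> norm f * norm v"
  by (simp add: norm_cdual.rep_eq onorm bounded_linear_cdual_apply)

lemma cdual_norm_le: "(\<And>v. cmod (cdual_apply f v) \<le> b * norm v) \<Longrightarrow> 0 \<le> b \<Longrightarrow> norm f \<le> b"
  by (simp add: norm_cdual.rep_eq onorm_bound)

lemma cdual_apply_scaleC: "cdual_apply f (c *\<^sub>C v) = c * cdual_apply f v"
  using bounded_clinear_cdual_apply[of f] by (simp add: bounded_clinear_def scaleC_complex_def)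

lemma linear_cdual_apply: "linear (cdual_apply f)"
  by (simp add: bounded_linear.linear bounded_linear_cdual_apply)

text \<open>
  The usual complexification \<open>v \<mapsto> g v - i g (i v)\<close>.
\<close>

lemma cdual_of_real_functional:
  fixes g :: "'a::complex_normed_vector \<Rightarrow> real"
  assumes g: "linear g" and le: "\<And>v. g v \<le> norm v"
  obtains F :: "'a cdual" where "norm F \<le> 1" "\<And>v. Re (cdual_apply F v) = g v"
proof -
  interpret g: linear g by fact
  define G where "G v = Complex (g v) (- g (\<i> *\<^sub>C v))" for v
  have add: "G (u + v) = G u + G v" for u v
    by (simp add: G_def g.add scaleC_add_right complex_eq_iff)
  have real: "G (r *\<^sub>R v) = r *\<^sub>R G v" for r v
    by (simp add: G_def g.scale scaleR_scaleC_commute complex_eq_iff)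
  have imag: "G (\<i> *\<^sub>C v) = \<i> * G v" for v
  proof -
    have m: "(-1) *\<^sub>C v = - v" using scaleR_scaleC[of "-1" v] by simp
    show ?thesis unfolding G_def scaleC_scaleC by (simp add: complex_eq_iff m g.neg)
  qed
  have scale: "G (c *\<^sub>C v) = c * G v" for c v
  proof -
    have "c *\<^sub>C v = Re c *\<^sub>R v + Im c *\<^sub>R (\<i> *\<^sub>C v)"
      unfolding scaleR_scaleC scaleC_scaleC scaleC_add_left[symmetric]
      by (subst complex_eq[of c]) (simp add: mult.commute)
    then have "G (c *\<^sub>C v) = Re c *\<^sub>R G v + Im c *\<^sub>R (\<i> * G v)" by (simp add: add real imag)
    also have "\<dots> = c * G v" by (simp add: complex_eq_iff)
    finally show ?thesis .
  qed
  \<comment> \<open>rotate the value onto the positive real axis\<close>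
  have bound: "cmod (G v) \<le> norm v" for v
  proof (cases "G v = 0")
    case False
    define c where "c = cnj (G v) / cmod (G v)"
    have "G (c *\<^sub>C v) = cmod (G v)"
      using False complex_norm_square[of "G v"]
      by (simp add: scale c_def field_simps power2_eq_square)
    then have "cmod (G v) = g (c *\<^sub>C v)" by (simp add: G_def complex_eq_iff)
    also have "\<dots> \<le> norm (c *\<^sub>C v)" by (rule le)
    also have "\<dots> = norm v" using False by (simp add: norm_scaleC c_def norm_divide)
    finally show ?thesis .
  qed simp
  have "bounded_clinear G"
    unfolding bounded_clinear_def scaleC_complex_def
    using bounded_linear_intro[of G 1] add real bound scale by auto
  then have ap: "cdual_apply (Abs_cdual G) = G" by (simp add: Abs_cdual_inverse)
  show ?thesis
    by (rule that[of "Abs_cdual G"]) (auto intro!: cdual_norm_le simp: ap bound, simp add: G_def)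
qed

lemma eq_of_real_if_Re_ge:
  assumes "Re z \<ge> r" "cmod z \<le> r"
  shows "z = complex_of_real r"
proof -
  have r: "Re z = r" using assms complex_Re_le_cmod[of z] by linarith
  have "(cmod z)\<^sup>2 \<le> r\<^sup>2" using assms by (intro power_mono) auto
  then have "(Im z)\<^sup>2 \<le> 0" using r cmod_power2[of z] by simp
  then show ?thesis using r by (simp add: complex_eq_iff)
qed

lemma norming_functional:
  fixes w :: "'a::complex_normed_vector"
  obtains F :: "'a cdual" where "norm F \<le> 1" "cdual_apply F w = norm w"
proof -
  obtain g :: "'a \<Rightarrow> real" where "linear g" "\<And>v. g v \<le> norm v" "g w = norm w"
    using Hahn_Banach_touching[OF sublinear_norm] by blast
  then obtain F :: "'a cdual" where F: "norm F \<le> 1" "Re (cdual_apply F w) = norm w"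
    using cdual_of_real_functional by metis
  have "cmod (cdual_apply F w) \<le> norm w"
    using cdual_bound[of F w] mult_right_mono[OF F(1), of "norm w"] by simp
  then have "cdual_apply F w = norm w" using F(2) by (intro eq_of_real_if_Re_ge) auto
  then show ?thesis using F that by blast
qed

text \<open>
  A substitute for a weak* cluster point of \<open>u\<close>: \<open>Re F\<close> is a linear functional below the upper limit
  of the functionals \<open>Re (u k)\<close>, which is sublinear.
\<close>

lemma generalized_limit:
  fixes u :: "nat \<Rightarrow> 'v::complex_normed_vector cdual"
  assumes u: "\<And>k. norm (u k) \<le> b" and "b > 0"
  obtains F :: "'v cdual" where "norm F \<le> b"
    "\<And>v a. (\<forall>\<^sub>F k in sequentially. Re (cdual_apply (u k) v) \<le> a) \<Longrightarrow> Re (cdual_apply F v) \<le> a"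
proof -
  define S where "S v = {a. \<forall>\<^sub>F k in sequentially. Re (cdual_apply (u k) v) / b \<le> a}" for v
  define p where "p v = Inf (S v)" for v
  have bound: "\<bar>Re (cdual_apply (u k) v) / b\<bar> \<le> norm v" for k v
  proof -
    have "\<bar>Re (cdual_apply (u k) v)\<bar> \<le> norm (u k) * norm v"
      using abs_Re_le_cmod cdual_bound order_trans by blast
    also have "\<dots> \<le> b * norm v" using u by (intro mult_right_mono) auto
    finally show ?thesis using \<open>b > 0\<close> by (simp add: field_simps)
  qed
  have lower: "- norm v \<le> a" if mem: "a \<in> S v" for v a
  proof -
    obtain k where "Re (cdual_apply (u k) v) / b \<le> a"
      using eventually_happens'[OF sequentially_bot] mem unfolding S_def by blast
    then show ?thesis using bound[of k v] by linarith
  qed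
  have bdd: "bdd_below (S v)" for v using lower by (rule bdd_belowI)
  have normS: "norm v \<in> S v" for v
    unfolding S_def mem_Collect_eq by (intro always_eventually allI abs_le_D1[OF bound])
  have pS: "p v \<le> a" if "a \<in> S v" for v a
    unfolding p_def using that bdd by (rule cInf_lower)
  have ex: "\<exists>a\<in>S v. a < c" if "p v < c" for v c
    using that bdd normS unfolding p_def by (subst (asm) cInf_less_iff) auto
  have "sublinear p"
  proof (rule sublinearI)
    fix v w
    show "p (v + w) \<le> p v + p w"
    proof (rule field_le_epsilon)
      fix e :: real assume "e > 0"
      obtain a where a: "a \<in> S v" "a < p v + e/2" using ex[of v "p v + e/2"] \<open>e > 0\<close> by auto
      obtain c where c: "c \<in> S w" "c < p w + e/2" using ex[of w "p w + e/2"] \<open>e > 0\<close> by auto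
      have "a + c \<in> S (v + w)"
        using a(1) c(1) unfolding S_def mem_Collect_eq
        by eventually_elim (simp add: linear_add[OF linear_cdual_apply] add_divide_distrib)
      then show "p (v + w) \<le> p v + p w + e" using pS a c by fastforce
    qed
  next
    fix r :: real and v assume r: "r > 0"
    show "p (r *\<^sub>R v) \<le> r * p v"
    proof (rule field_le_epsilon)
      fix e :: real assume "e > 0"
      obtain a where a: "a \<in> S v" "a < p v + e/r" using ex[of v "p v + e/r"] \<open>e > 0\<close> r by auto
      have "r * a \<in> S (r *\<^sub>R v)"
        using a(1) unfolding S_def mem_Collect_eq
      proof eventually_elim
        case (elim k)
        then have "r * (Re (cdual_apply (u k) v) / b) \<le> r * a" using r by (intro mult_left_mono) auto
        then show ?case by (simp add: linear_scale[OF linear_cdual_apply])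
      qed
      then have "p (r *\<^sub>R v) \<le> r * a" by (rule pS)
      also have "\<dots> \<le> r * (p v + e/r)" using a r by (intro mult_left_mono) auto
      finally show "p (r *\<^sub>R v) \<le> r * p v + e" using r by (simp add: algebra_simps)
    qed
  next
    have "p 0 \<le> 0" using pS[of 0 0] by (simp add: S_def linear_0[OF linear_cdual_apply])
    moreover have "0 \<le> p 0"
    proof (rule ccontr)
      assume "\<not> 0 \<le> p 0"
      then obtain a where "a \<in> S 0" "a < 0" using ex[of 0 0] by auto
      then show False using lower[of a 0] by simp
    qed
    ultimately show "p 0 = 0" by simp
  qed
  then obtain g where g: "linear g" "\<And>v. g v \<le> p v" using Hahn_Banach by blast
  have gn: "g v \<le> norm v" for v using g(2)[of v] pS[OF normS, of v] by simp
  obtain F :: "'v cdual" where F: "norm F \<le> 1" "\<And>v. Re (cdual_apply F v) = g v"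
    using cdual_of_real_functional[OF g(1) gn] by metis
  define F' where "F' = complex_of_real b *\<^sub>C F"
  have "norm F' \<le> b" using F(1) \<open>b > 0\<close> by (simp add: F'_def norm_scaleC)
  moreover have "Re (cdual_apply F' v) \<le> a"
    if "\<forall>\<^sub>F k in sequentially. Re (cdual_apply (u k) v) \<le> a" for v a
  proof -
    have "\<forall>\<^sub>F k in sequentially. Re (cdual_apply (u k) v) / b \<le> a / b"
      using that by eventually_elim (use \<open>b > 0\<close> in \<open>simp add: divide_right_mono\<close>)
    then have "g v \<le> a / b" using g(2)[of v] pS[of "a/b" v] by (auto simp: S_def)
    then show ?thesis using F(2)[of v] \<open>b > 0\<close> by (simp add: F'_def scaleC_cdual.rep_eq field_simps)
  qed
  ultimately show ?thesis using that by blast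
qed

section \<open>Very smooth points\<close>

lemma bidual_embed_apply: "cdual_apply (bidual_embed v) f = cdual_apply f v"
  by (simp add: bidual_embed.rep_eq)

lemma norm_bidual_embed_le: "norm (bidual_embed v) \<le> norm v"
  by (rule cdual_norm_le) (use cdual_bound in \<open>auto simp: bidual_embed_apply mult.commute\<close>)

lemma very_smooth_unique_extension:
  fixes x :: "'a::complex_normed_vector"
  assumes vs: "very_smooth_point x"
    and f: "norm f \<le> 1" "cdual_apply f x = 1"
    and H: "norm H \<le> 1" "cdual_apply H (bidual_embed x) = 1"
  shows "cdual_apply H z = cdual_apply z f"
proof -
  have x: "norm x = 1" using vs by (simp add: very_smooth_point_def)
  have xx: "norm (bidual_embed x) \<le> 1" using norm_bidual_embed_le[of x] x by simp
  have one: "norm K = 1" if "norm K \<le> 1" "cdual_apply K (bidual_embed x) = 1" for K :: "'a cdual cdual cdual"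
  proof -
    have "1 \<le> norm K * norm (bidual_embed x)" using cdual_bound[of K "bidual_embed x"] that by simp
    also have "\<dots> \<le> norm K * 1" using xx by (intro mult_left_mono) auto
    finally show ?thesis using that by simp
  qed
  have "norm (bidual_embed f) \<le> 1" using norm_bidual_embed_le[of f] f by simp
  moreover have "cdual_apply (bidual_embed f) (bidual_embed x) = 1"
    using f by (simp add: bidual_embed_apply)
  ultimately have "bidual_embed f = H"
    using vs one H unfolding very_smooth_point_def smooth_point_def by blast
  then show ?thesis by (auto simp: bidual_embed_apply)
qed

lemma very_smooth_unique_support:
  assumes vs: "very_smooth_point x"
    and f: "norm f \<le> 1" "cdual_apply f x = 1"
    and g: "norm g \<le> 1" "cdual_apply g x = 1"
  shows "g = f"
proof (rule cdual_eqI)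
  fix v
  have "cdual_apply (bidual_embed g) (bidual_embed v) = cdual_apply (bidual_embed v) f"
    by (rule very_smooth_unique_extension[OF vs f])
      (use norm_bidual_embed_le[of g] g in \<open>auto simp: bidual_embed_apply\<close>)
  then show "cdual_apply g v = cdual_apply f v" by (simp add: bidual_embed_apply)
qed

text \<open>
  The weak convergence of almost norming functionals, tested against a cluster point of \<open>y\<close> in the
  bidual: the limits of \<open>\<phi> k (y j)\<close> over \<open>j\<close> and \<open>k\<close> cannot be interchanged here.
\<close>

lemma very_smooth_iterated_limit:
  fixes x :: "'a::complex_normed_vector" and \<phi> :: "nat \<Rightarrow> 'a cdual" and y :: "nat \<Rightarrow> 'a"
  assumes vs: "very_smooth_point x"
    and f: "norm f \<le> 1" "cdual_apply f x = 1"
    and \<phi>: "\<And>k. norm (\<phi> k) \<le> 1" "\<And>k. Re (cdual_apply (\<phi> k) x) \<ge> 1 - \<epsilon> k"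
    and \<epsilon>: "\<epsilon> \<longlonglongrightarrow> 0"
    and y: "\<And>j. norm (y j) \<le> 1" "\<And>j. Re (cdual_apply f (y j)) \<ge> 1"
    and iter: "\<And>k. \<forall>\<^sub>F j in sequentially. Re (cdual_apply (\<phi> k) (y j)) \<le> \<epsilon> k"
  shows False
proof -
  \<comment> \<open>\<open>Y\<close> is a cluster point of \<open>y\<close> in the bidual, \<open>H\<close> one of \<open>\<phi>\<close> in the third dual\<close>
  have "norm (bidual_embed (y j)) \<le> 1" for j
    using norm_bidual_embed_le[of "y j"] y(1)[of j] by simp
  then obtain Y :: "'a cdual cdual" where Y: "norm Y \<le> 1"
    "\<And>v a. (\<forall>\<^sub>F k in sequentially. Re (cdual_apply (bidual_embed (y k)) v) \<le> a) \<Longrightarrow> Re (cdual_apply Y v) \<le> a"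
    using generalized_limit[of "\<lambda>j. bidual_embed (y j)" 1] by auto
  have "Re (cdual_apply Y (- f)) \<le> -1"
    by (rule Y(2)) (use y(2) in \<open>auto simp: bidual_embed_apply uminus_cdual.rep_eq\<close>)
  then have Yf: "Re (cdual_apply Y f) \<ge> 1"
    by (simp add: linear_neg[OF linear_cdual_apply])
  have Y\<phi>: "Re (cdual_apply Y (\<phi> k)) \<le> \<epsilon> k" for k
    by (rule Y(2)) (use iter[of k] in \<open>simp add: bidual_embed_apply\<close>)
  have "norm (bidual_embed (\<phi> j)) \<le> 1" for j
    using norm_bidual_embed_le[of "\<phi> j"] \<phi>(1)[of j] by simp
  then obtain H :: "'a cdual cdual cdual" where H: "norm H \<le> 1"
    "\<And>v a. (\<forall>\<^sub>F k in sequentially. Re (cdual_apply (bidual_embed (\<phi> k)) v) \<le> a) \<Longrightarrow> Re (cdual_apply H v) \<le> a"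
    using generalized_limit[of "\<lambda>j. bidual_embed (\<phi> j)" 1] by auto
  have small: "\<forall>\<^sub>F k in sequentially. \<epsilon> k \<le> d" if "d > 0" for d
    using order_tendstoD(2)[OF \<epsilon> that] by eventually_elim simp
  have "Re (cdual_apply H (- bidual_embed x)) \<le> -1 + d" if "d > 0" for d
  proof (rule H(2))
    show "\<forall>\<^sub>F k in sequentially. Re (cdual_apply (bidual_embed (\<phi> k)) (- bidual_embed x)) \<le> -1 + d"
      using small[OF that]
    proof eventually_elim
      case (elim k)
      then show ?case using \<phi>(2)[of k]
        by (simp add: bidual_embed_apply linear_neg[OF linear_cdual_apply])
    qed
  qed
  then have "Re (cdual_apply H (- bidual_embed x)) \<le> -1" by (rule field_le_epsilon)
  then have Re: "Re (cdual_apply H (bidual_embed x)) \<ge> 1" by (simp add: linear_neg[OF linear_cdual_apply])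
  have "norm x = 1" using vs by (simp add: very_smooth_point_def)
  then have "norm H * norm (bidual_embed x) \<le> 1 * 1"
    using norm_bidual_embed_le[of x] H(1) by (intro mult_mono) auto
  then have "cmod (cdual_apply H (bidual_embed x)) \<le> 1"
    using cdual_bound[of H "bidual_embed x"] by simp
  then have "cdual_apply H (bidual_embed x) = 1" using Re using eq_of_real_if_Re_ge[of 1] by simp
  then have HY: "cdual_apply H Y = cdual_apply Y f"
    by (intro very_smooth_unique_extension[OF vs f H(1)])
  have "Re (cdual_apply H Y) \<le> 1/2"
  proof (rule H(2))
    show "\<forall>\<^sub>F k in sequentially. Re (cdual_apply (bidual_embed (\<phi> k)) Y) \<le> 1/2"
      using small[of "1/2", simplified]
    proof eventually_elim
      case (elim k)
      then show ?case using Y\<phi>[of k] by (simp add: bidual_embed_apply)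
    qed
  qed
  then show False using HY Yf by simp
qed

section \<open>Polynomials in an operator\<close>

text \<open>
  The scalars are abstract because both the real and the complex polynomials in \<open>D(x, x)\<close> occur:
  odd real polynomials give the elements of interest, complex ones have roots.
\<close>

locale polynomial_action = module scale
  for scale :: "'b::comm_ring_1 \<Rightarrow> 'a::ab_group_add \<Rightarrow> 'a" (infixr \<open>*s\<close> 75) +
  fixes T :: "'a \<Rightarrow> 'a"
  assumes T_add: "T (u + v) = T u + T v"
    and T_scale: "T (c *s v) = c *s T v"
begin

lemma T_0: "T 0 = 0"
  using T_scale[of 0 0] by simp

definition act :: "'b poly \<Rightarrow> 'a \<Rightarrow> 'a"
  where "act p v = fold_coeffs (\<lambda>a r. a *s v + T r) p 0"

lemma act_0 [simp]: "act 0 v = 0"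
  by (simp add: act_def)

lemma act_pCons [simp]: "act (pCons a p) v = a *s v + T (act p v)"
  by (cases "p = 0 \<and> a = 0") (auto simp: act_def T_0)

lemma act_add: "act (p + q) v = act p v + act q v"
  by (induction p q rule: poly_induct2) (simp_all add: T_add T_0 scale_left_distrib algebra_simps)

lemma act_smult: "act (smult c p) v = c *s act p v"
  by (induction p) (simp_all add: T_scale scale_right_distrib)

lemma act_diff: "act (p - q) v = act p v - act q v"
  using act_add[of "p - q" q v] by (simp add: algebra_simps)

lemma act_add_right: "act p (u + v) = act p u + act p v"
  by (induction p) (simp_all add: T_add scale_right_distrib algebra_simps)

lemma act_scale_right: "act p (c *s v) = c *s act p v"
  by (induction p) (simp_all add: T_scale scale_right_distrib mult.commute)

lemma act_0_right [simp]: "act p 0 = 0"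
  using act_scale_right[of p 0 0] by simp

lemma act_T: "act p (T v) = T (act p v)"
  by (induction p) (simp_all add: T_add T_scale T_0)

lemma act_mult: "act (p * q) v = act p (act q v)"
  by (induction p) (simp_all add: act_add act_smult)

lemma act_1 [simp]: "act 1 v = v"
  by (simp add: one_pCons T_0)

lemma act_power: "act (p ^ n) v = (act p ^^ n) v"
  by (induction n arbitrary: v) (simp_all add: act_mult)

lemma act_X_power: "act ([:0, 1:] ^ n) v = (T ^^ n) v"
  by (induction n) (simp_all add: act_mult T_0)

end

text \<open>
  Through \<open>\<parallel>{a, a, a}\<parallel> = \<parallel>a\<parallel>\<^sup>3\<close> this removes multiplicative constants from norm estimates.
\<close>

lemma le_if_cubic_powers_le:
  fixes a b K :: real
  assumes "a \<ge> 0" "b \<ge> 0" and le: "\<And>k. a ^ (3 ^ k) \<le> K * b ^ (3 ^ k)"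
  shows "a \<le> b"
proof (rule ccontr)
  assume "\<not> a \<le> b"
  then have ab: "b < a" by simp
  show False
  proof (cases "b = 0")
    case True
    then show False using le[of 0] ab by simp
  next
    case False
    then have b: "b > 0" using assms by simp
    obtain n where n: "K < (a / b) ^ n" using real_arch_pow[of "a / b" K] ab b by auto
    have "n \<le> 3 ^ n" by (rule less_imp_le[OF less_exp[THEN less_le_trans]]) (simp add: power_mono)
    then have "(a / b) ^ n \<le> (a / b) ^ (3 ^ n)" using ab b by (intro power_increasing) auto
    also have "\<dots> \<le> K" using le[of n] b by (simp add: power_divide field_simps)
    finally show False using n by simp
  qed
qed

section \<open>Odd powers in a JB*-triple\<close>

context jb_star_triple
begin

lemma add_right: "triple a b (c + c') = triple a b c + triple a b c'"
  by (metis add_left symmetric)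

lemma scaleC_right: "triple a b (k *\<^sub>C c) = k *\<^sub>C triple a b c"
  by (metis scaleC_left symmetric)

lemma scaleR_left: "triple (r *\<^sub>R a) b c = r *\<^sub>R triple a b c"
  and scaleR_middle: "triple a (r *\<^sub>R b) c = r *\<^sub>R triple a b c"
  and scaleR_right: "triple a b (r *\<^sub>R c) = r *\<^sub>R triple a b c"
  by (simp_all add: scaleR_scaleC scaleC_left scaleC_middle scaleC_right)

lemma minus_middle: "triple a (- b) c = - triple a b c"
  and minus_right: "triple a b (- c) = - triple a b c"
  using scaleR_middle[of _ "-1"] scaleR_right[of _ _ "-1"] by simp_all

lemma zero_left: "triple 0 b c = 0"
  and zero_middle: "triple a 0 c = 0"
  and zero_right: "triple a b 0 = 0"
  using scaleR_left[of 0 0] scaleR_middle[of _ 0 0] scaleR_right[of _ _ 0 0] by simp_all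

lemma diff_middle: "triple a (b - b') c = triple a b c - triple a b' c"
  and diff_right: "triple a b (c - c') = triple a b c - triple a b c'"
  using add_middle[of a b "- b'"] add_right[of a b c "- c'"]
  by (simp_all add: minus_middle minus_right)

lemma triple_bounded: "\<exists>M\<ge>1. \<forall>a b c. norm (triple a b c) \<le> M * norm a * norm b * norm c"
proof -
  have "continuous (at (0, 0, 0)) (\<lambda>(a, b, c). triple a b c)"
    using continuous by (simp add: continuous_on_eq_continuous_at)
  then obtain d where d: "d > 0"
    "\<And>z. dist z (0, 0, 0) < d \<Longrightarrow> dist ((\<lambda>(a, b, c). triple a b c) z) ((\<lambda>(a, b, c). triple a b c) (0, 0, 0)) < 1"
    unfolding continuous_at_eps_delta by (metis zero_less_one)
  define s where "s = d / 4"
  have s: "s > 0" using d by (simp add: s_def)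
  have small: "norm (triple a b c) \<le> 1" if "norm a \<le> s" "norm b \<le> s" "norm c \<le> s" for a b c
  proof -
    have "norm (a, b, c) \<le> norm a + (norm b + norm c)"
      using norm_Pair_le[of a "(b, c)"] norm_Pair_le[of b c] by simp
    also have "\<dots> < d" using that s by (simp add: s_def)
    finally have "dist (a, b, c) (0, 0, 0) < d" by (simp add: dist_norm)
    from d(2)[OF this] show ?thesis by (simp add: dist_norm zero_left)
  qed
  have "norm (triple a b c) \<le> max 1 (1 / s ^ 3) * norm a * norm b * norm c" for a b c
  proof (cases "a = 0 \<or> b = 0 \<or> c = 0")
    case True
    then show ?thesis by (auto simp: zero_left zero_middle zero_right)
  next
    case False
    define k where "k v = s / norm v" for v :: 'a
    have "norm (triple (k a *\<^sub>R a) (k b *\<^sub>R b) (k c *\<^sub>R c)) \<le> 1"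
      using s False by (intro small) (auto simp: k_def)
    then have "k a * k b * k c * norm (triple a b c) \<le> 1"
      using s by (simp add: scaleR_left scaleR_middle scaleR_right k_def abs_mult mult_ac)
    also have "k a * k b * k c = s ^ 3 / (norm a * norm b * norm c)"
      by (simp add: k_def power3_eq_cube)
    finally have "norm (triple a b c) \<le> (norm a * norm b * norm c) / s ^ 3"
      using s False mult_pos_pos[of "norm a * norm b" "norm c"]
      by (simp add: pos_le_divide_eq pos_divide_le_eq mult.commute)
    then have "norm (triple a b c) \<le> 1 / s ^ 3 * (norm a * norm b * norm c)" by simp
    also have "\<dots> \<le> max 1 (1 / s ^ 3) * (norm a * norm b * norm c)"
      by (intro mult_right_mono) auto
    finally show ?thesis by (simp add: mult.assoc)
  qed
  then show ?thesis by (intro exI[of _ "max 1 (1 / s ^ 3)"]) auto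
qed

text \<open>
  Power associativity. By induction on \<open>i + j + k\<close>, let \<open>A i j k\<close> be the defect of the claim. The
  Jordan identity for \<open>D(x, x)\<close> yields a derivation rule for \<open>A\<close>; the one for \<open>D(y i, y j)\<close>, applied
  to \<open>{x, x, y k}\<close>, shows that \<open>A i j (k + 1)\<close> depends only on \<open>i + j\<close> and \<open>k\<close>. Together with the
  symmetry of \<open>A\<close> in its outer arguments this leaves one value, which is then shown to vanish.
\<close>

lemma triple_powers:
  fixes x :: 'a
  defines "y \<equiv> \<lambda>n. (triple x x ^^ n) x"
  shows "triple (y i) (y j) (y k) = y (i + j + k + 1)"
proof -
  have T: "triple x x (y n) = y (Suc n)" for n by (simp add: y_def)
  have y0: "y 0 = x" by (simp add: y_def)
  have "\<forall>i j k. i + j + k \<le> n \<longrightarrow> triple (y i) (y j) (y k) = y (i + j + k + 1)" for n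
  proof (induction n)
    case 0
    then show ?case using T[of 0] by (simp add: y0)
  next
    case (Suc n)
    then have IH: "triple (y i) (y j) (y k) = y (Suc (i + j + k))" if "i + j + k \<le> n" for i j k
      using that by simp
    define A where "A i j k = triple (y i) (y j) (y k) - y (n + 2)" for i j k
    have sym: "A i j k = A k j i" for i j k by (simp add: A_def symmetric)
    have A0: "A 0 0 (Suc n) = 0" using T[of "Suc n"] by (simp add: A_def y0)
    have deriv: "A (Suc i) j k - A i (Suc j) k + A i j (Suc k) = 0" if "i + j + k = n" for i j k
      using jordan_identity[of x x "y i" "y j" "y k"] that IH[of i j k] by (simp add: A_def T)
    have shift: "A i j (Suc k) = A (Suc (i + j)) 0 k - A 0 (Suc (i + j)) k" if "i + j + k = n" for i j k
    proof -
      have ij: "triple (y i) (y j) x = y (Suc (i + j))" "triple (y j) (y i) x = y (Suc (i + j))"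
        using IH[of i j 0] IH[of j i 0] that by (simp_all add: y0 add.commute)
      show ?thesis
        using jordan_identity[of "y i" "y j" x x "y k"] that IH[of i j k]
        by (simp add: A_def T ij) (simp add: y0)
    qed
    have middle: "A i j (Suc k) = A i' j' (Suc k)" if "i + j = i' + j'" "i + j + k = n" for i j i' j' k
      using shift[of i j k] shift[of i' j' k] that by simp
    \<comment> \<open>\<open>A 0 n 1\<close> equals both \<open>- A 0 (n + 1) 0\<close> and half of \<open>A 0 (n + 1) 0\<close>\<close>
    have "A 0 n 1 = A (Suc n) 0 0 - A 0 (Suc n) 0" using shift[of 0 n 0] by simp
    then have 1: "A 0 (Suc n) 0 = - A 0 n 1" using A0 sym[of "Suc n" 0 0] by simp
    have "A 1 n 0 - A 0 (Suc n) 0 + A 0 n 1 = 0" using deriv[of 0 n 0] by simp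
    then have "A 0 n 1 + A 0 n 1 + A 0 n 1 = 0" using 1 sym[of 1 n 0] by simp
    then have "3 *\<^sub>R A 0 n 1 = 0" by (simp add: scaleR_left_distrib[of 1 2, simplified] scaleR_2 add.commute)
    then have z: "A 0 n 1 = 0" by simp
    have last: "A i j (Suc k) = 0" if "i + j + k = n" for i j k
    proof (cases "i + j = 0")
      case True
      then show ?thesis using A0 that by simp
    next
      case False
      then have "A i j (Suc k) = A 1 (i + j - 1) (Suc k)" using that by (intro middle) auto
      also have "\<dots> = A (Suc k) (i + j - 1) (Suc 0)" by (simp add: sym)
      also have "\<dots> = A 0 n (Suc 0)" using False that by (intro middle) auto
      finally show ?thesis using z by simp
    qed
    have zero: "A i j k = 0" if "i + j + k = Suc n" for i j k
    proof (cases k)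
      case (Suc k')
      then show ?thesis using last that by simp
    next
      case k: 0
      show ?thesis
      proof (cases i)
        case (Suc i')
        then show ?thesis using last[of k j i'] sym[of i j k] that by simp
      next
        case 0
        then show ?thesis using k that 1 z by simp
      qed
    qed
    show ?case
    proof (intro allI impI)
      fix i j k assume "i + j + k \<le> Suc n"
      then consider "i + j + k \<le> n" | "i + j + k = Suc n" by linarith
      then show "triple (y i) (y j) (y k) = y (i + j + k + 1)"
      proof cases
        case 2
        then show ?thesis using zero[OF 2] by (simp add: A_def)
      qed (use IH in simp)
    qed
  qed
  then show ?thesis by blast
qed

end

locale jb_unit_vector = jb_star_triple triple
  for triple :: "'a::complex_banach \<Rightarrow> 'a \<Rightarrow> 'a \<Rightarrow> 'a" +
  fixes x :: 'a
  assumes unit: "norm x = 1"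
begin

abbreviation T :: "'a \<Rightarrow> 'a" where "T \<equiv> triple x x"

sublocale re: polynomial_action "scaleR :: real \<Rightarrow> 'a \<Rightarrow> 'a" T
  by standard (simp_all add: algebra_simps add_right scaleR_right)

lemma triple_re_act:
  "triple (re.act p x) (re.act q x) (re.act r x) = re.act ([:0, 1:] * p * q * r) x"
proof -
  define y where "y n = (T ^^ n) x" for n
  have y: "triple (y i) (y j) (y k) = y (i + j + k + 1)" "T (y i) = y (Suc i)" for i j k
    unfolding y_def by (rule triple_powers) simp
  have Ty: "T (re.act p (y i)) = re.act p (y (Suc i))" for p i
    by (simp add: y(2) flip: re.act_T)
  have 1: "triple (re.act p (y i)) (y j) (y k) = re.act p (y (i + j + k + 1))" for p i j k
    by (induction p arbitrary: i) (simp_all add: zero_left add_left scaleR_left y(1) Ty)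
  have 2: "triple (re.act p (y i)) (re.act q (y j)) (y k) = re.act p (re.act q (y (i + j + k + 1)))"
    for p q i j k
    by (induction q arbitrary: j)
      (simp_all add: zero_middle add_middle scaleR_middle 1 Ty re.act_add_right re.act_scale_right)
  have 3: "triple (re.act p (y i)) (re.act q (y j)) (re.act r (y k)) =
      re.act p (re.act q (re.act r (y (i + j + k + 1))))" for p q r i j k
    by (induction r arbitrary: k)
      (simp_all add: zero_right add_right scaleR_right 2 Ty re.act_add_right re.act_scale_right)
  have "triple (re.act p (y 0)) (re.act q (y 0)) (re.act r (y 0)) = re.act ([:0, 1:] * p * q * r) (y 0)"
    using y(2)[of 0] by (simp add: 3 re.act_mult re.T_0 flip: re.act_T)
  then show ?thesis by (simp add: y_def)
qed

text \<open>
  Under \<open>t = s\<^sup>2\<close> the polynomial \<open>p(t)\<close> stands for the odd polynomial \<open>s p(s\<^sup>2)\<close> in \<open>x\<close>. This is why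
  the triple product of \<open>p\<close>, \<open>q\<close> and \<open>r\<close> becomes \<open>t p q r\<close>.
\<close>

definition N :: "real poly \<Rightarrow> real" where "N p = norm (re.act p x)"

lemma N_nonneg: "N p \<ge> 0" and N_1: "N 1 = 1"
  by (simp_all add: N_def unit)

lemma N_add: "N (p + q) \<le> N p + N q" and N_smult: "N (smult c p) = \<bar>c\<bar> * N p"
  by (simp_all add: N_def re.act_add re.act_smult norm_triangle_ineq)

lemma N_cube: "N ([:0, 1:] * p ^ 3) = N p ^ 3"
  using norm_cube[of "re.act p x"] by (simp add: N_def triple_re_act power3_eq_cube mult.assoc)

definition cube_poly :: "nat \<Rightarrow> real poly \<Rightarrow> real poly"
  where "cube_poly k = (\<lambda>p. [:0, 1:] * p ^ 3) ^^ k"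

lemma cube_poly_Suc: "cube_poly (Suc k) p = [:0, 1:] * cube_poly k p ^ 3"
  by (simp add: cube_poly_def)

lemma N_cube_poly: "N (cube_poly k p) = N p ^ (3 ^ k)"
proof (induction k)
  case 0 then show ?case by (simp add: cube_poly_def)
next
  case (Suc k)
  then show ?case by (simp only: cube_poly_Suc N_cube power_Suc2 power_mult)
qed

lemma cube_poly_eq: "cube_poly k p = ([:0, 1:] * p ^ 2) ^ ((3 ^ k - 1) div 2) * p"
proof (induction k)
  case 0 then show ?case by (simp add: cube_poly_def)
next
  case (Suc k)
  define n :: nat where "n = (3 ^ k - 1) div 2"
  have "odd ((3::nat) ^ k)" by simp
  then have "(3::nat) ^ k = 2 * n + 1" unfolding n_def by (metis add_diff_cancel_right' div_mult_self1_is_m oddE zero_less_numeral)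
  then have e: "(3 ^ Suc k - 1) div 2 = 3 * n + 1" by simp
  define g where "g = [:0, 1:] * p ^ 2"
  have "cube_poly (Suc k) p = [:0, 1:] * (g ^ n * p) ^ 3"
    using Suc by (simp add: cube_poly_Suc n_def g_def)
  also have "\<dots> = g ^ (3 * n) * g * p"
    unfolding power_mult_distrib power_mult[symmetric] mult.commute[of n 3]
    by (simp add: g_def power2_eq_square power3_eq_cube mult_ac)
  finally show ?case unfolding e g_def by (simp add: mult_ac)
qed

lemma cube_poly_triple: "cube_poly k ([:0, 1:] * p * q * r) = [:0, 1:] * cube_poly k p * cube_poly k q * cube_poly k r"
proof (induction k)
  case (Suc k)
  then show ?case
    unfolding cube_poly_Suc by (simp only: power_mult_distrib power3_eq_cube mult_ac)
qed (simp add: cube_poly_def)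

text \<open>
  Continuity of the triple product gives this with some constant factor. The identity for cubes
  removes the factor, since cubing respects the product \<open>t p q r\<close>.
\<close>

lemma N_triple: "N ([:0, 1:] * p * q * r) \<le> N p * N q * N r"
proof -
  obtain M where M: "M \<ge> 1" "\<And>a b c. norm (triple a b c) \<le> M * norm a * norm b * norm c"
    using triple_bounded by blast
  show ?thesis
  proof (rule le_if_cubic_powers_le[where K = M])
    fix k :: nat
    have "N ([:0, 1:] * p * q * r) ^ 3 ^ k = N ([:0, 1:] * cube_poly k p * cube_poly k q * cube_poly k r)"
      by (simp only: cube_poly_triple flip: N_cube_poly)
    also have "\<dots> \<le> M * N (cube_poly k p) * N (cube_poly k q) * N (cube_poly k r)"
      using M(2)[of "re.act (cube_poly k p) x" "re.act (cube_poly k q) x" "re.act (cube_poly k r) x"]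
      unfolding triple_re_act by (simp add: N_def)
    finally show "N ([:0, 1:] * p * q * r) ^ 3 ^ k \<le> M * (N p * N q * N r) ^ 3 ^ k"
      by (simp add: N_cube_poly power_mult_distrib mult.assoc)
  qed (simp_all add: N_nonneg)
qed

lemma N_X_mult: "N ([:0, 1:] * p) \<le> N p"
  using N_triple[of p 1 1] by (simp add: N_1)

lemma N_X_power_mult: "N ([:0, 1:] ^ n * p) \<le> N p"
proof (induction n)
  case (Suc n)
  then show ?case using N_X_mult[of "[:0, 1:] ^ n * p"] by (simp only: power_Suc mult.assoc)
qed simp

lemma N_odd_power: "N ([:0, 1:] ^ j * p ^ (2 * j + 1)) \<le> N p ^ (2 * j + 1)"
proof (induction j)
  case (Suc j)
  have e: "2 * Suc j + 1 = Suc (Suc (2 * j + 1))" by simp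
  have "[:0, 1:] ^ Suc j * p ^ (2 * Suc j + 1) = [:0, 1:] * p * p * ([:0, 1:] ^ j * p ^ (2 * j + 1))"
    unfolding e by (simp only: power_Suc mult_ac)
  then have "N ([:0, 1:] ^ Suc j * p ^ (2 * Suc j + 1)) \<le> N p * N p * N ([:0, 1:] ^ j * p ^ (2 * j + 1))"
    using N_triple[of p p "[:0, 1:] ^ j * p ^ (2 * j + 1)"] by (simp only:)
  also have "\<dots> \<le> N p * N p * N p ^ (2 * j + 1)"
    using Suc N_nonneg by (intro mult_left_mono) auto
  finally show ?case by (simp add: mult_ac)
qed simp

end

section \<open>Resolvents and the growth of powers\<close>

lemma bounded_clinear_add: "bounded_clinear S \<Longrightarrow> S (u + v) = S u + S v"
  by (simp add: bounded_clinear_def linear_add bounded_linear.linear)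

lemma bounded_clinear_diff: "bounded_clinear S \<Longrightarrow> S (u - v) = S u - S v"
  by (simp add: bounded_clinear_def linear_diff bounded_linear.linear)

lemma bounded_clinear_scaleC: "bounded_clinear S \<Longrightarrow> S (c *\<^sub>C u) = c *\<^sub>C S u"
  by (simp add: bounded_clinear_def)

lemma bounded_clinearI:
  assumes "\<And>u v. S (u + v) = S u + S v" "\<And>c u. S (c *\<^sub>C u) = c *\<^sub>C S u" "\<And>u. norm (S u) \<le> norm u * K"
  shows "bounded_clinear S"
  unfolding bounded_clinear_def
  by (intro conjI allI assms(2) bounded_linear_intro[where K = K]) (simp_all add: assms scaleR_scaleC)

lemma bounded_clinear_compose:
  assumes "bounded_clinear R" "bounded_clinear S"
  shows "bounded_clinear (\<lambda>v. R (S v))"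
  using assms by (auto simp: bounded_clinear_def intro: bounded_linear_compose)

lemma bounded_clinear_scaleC_compose:
  assumes "bounded_clinear S"
  shows "bounded_clinear (\<lambda>v. c *\<^sub>C S v)"
proof (rule bounded_clinearI)
  show "norm (c *\<^sub>C S u) \<le> norm u * (cmod c * onorm S)" for u
    using mult_left_mono[OF onorm[of S u], of "cmod c"] assms
    by (simp add: norm_scaleC bounded_clinear_def mult_ac)
qed (simp_all add: bounded_clinear_add[OF assms] bounded_clinear_scaleC[OF assms] scaleC_add_right
    scaleC_scaleC mult.commute)

lemma bounded_clinear_add_compose:
  "bounded_clinear R \<Longrightarrow> bounded_clinear S \<Longrightarrow> bounded_clinear (\<lambda>v. R v + S v)"
  by (auto simp: bounded_clinear_def scaleC_add_right intro: bounded_linear_add)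

lemma bounded_clinear_ident: "bounded_clinear (\<lambda>v. v)"
  by (simp add: bounded_clinear_def bounded_linear_ident)

lemma bounded_clinear_funpow:
  fixes S :: "'a::complex_normed_vector \<Rightarrow> 'a"
  assumes "bounded_clinear S"
  shows "bounded_clinear (S ^^ n)"
proof (induction n)
  case 0
  then show ?case using bounded_clinear_ident by (simp add: id_def)
next
  case (Suc n)
  then show ?case using bounded_clinear_compose[OF assms Suc] by (simp add: comp_def)
qed

definition inverts :: "('a::complex_normed_vector \<Rightarrow> 'a) \<Rightarrow> ('a \<Rightarrow> 'a) \<Rightarrow> bool"
  where "inverts S A \<longleftrightarrow> bounded_clinear S \<and> (\<forall>v. S (A v) = v) \<and> (\<forall>v. A (S v) = v)"

text \<open>
  The resolvent \<open>(1 - z G)\<inverse>\<close> is bounded on the disc by compactness. Applying a functional to it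
  gives a holomorphic function whose Taylor coefficients at \<open>0\<close> are the values of the functional
  on the powers of \<open>G\<close>, so that Cauchy's inequality bounds these powers.
\<close>

lemma power_bound_of_resolvent:
  fixes G :: "'a::complex_banach \<Rightarrow> 'a"
  assumes G: "bounded_clinear G" and r: "r > 0"
    and inv: "\<And>z. cmod z \<le> r \<Longrightarrow> \<exists>S. inverts S (\<lambda>v. v - z *\<^sub>C G v)"
  shows "\<exists>K\<ge>0. \<forall>n v. norm ((G ^^ n) v) * r ^ n \<le> K * norm v"
proof -
  have "\<forall>z. \<exists>S. cmod z \<le> r \<longrightarrow> inverts S (\<lambda>v. v - z *\<^sub>C G v)" using inv by blast
  then obtain S where S0: "\<And>z. cmod z \<le> r \<Longrightarrow> inverts (S z) (\<lambda>v. v - z *\<^sub>C G v)" by metis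
  have S: "bounded_clinear (S z)" "S z (v - z *\<^sub>C G v) = v" "S z v - z *\<^sub>C G (S z v) = v"
    if "cmod z \<le> r" for z v
    using S0[OF that] by (auto simp: inverts_def)
  define g where "g = onorm G + 1"
  have g: "g > 0" "norm (G v) \<le> g * norm v" for v
    using onorm[of G v] onorm_pos_le[of G] G
    by (auto simp: g_def bounded_clinear_def algebra_simps intro: order_trans)
  define c where "c z = onorm (S z)" for z
  have c: "c z \<ge> 0" "norm (S z v) \<le> c z * norm v" if "cmod z \<le> r" for z v
    using S(1)[OF that] by (auto simp: c_def bounded_clinear_def onorm onorm_pos_le)
  have resolvent: "S z v - S w v = (z - w) *\<^sub>C S z (G (S w v))" if z: "cmod z \<le> r" and w: "cmod w \<le> r" for z w v
  proof -
    have "v = (S w v - z *\<^sub>C G (S w v)) + (z - w) *\<^sub>C G (S w v)"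
      using S(3)[OF w, of v] scaleC_add_left[of "z - w" w "G (S w v)"] by (simp add: algebra_simps)
    then have "S z v = S z (S w v - z *\<^sub>C G (S w v)) + S z ((z - w) *\<^sub>C G (S w v))"
      by (metis bounded_clinear_add[OF S(1)[OF z]])
    then show ?thesis by (simp add: S(2)[OF z] bounded_clinear_scaleC[OF S(1)[OF z]])
  qed
  \<comment> \<open>on the disc of radius \<open>d w\<close> around \<open>w\<close> the resolvent at most doubles its norm\<close>
  define d where "d w = 1 / (2 * g * (c w + 1))" for w
  have local_bound: "c z \<le> 2 * c w" if z: "cmod z \<le> r" and w: "cmod w \<le> r" and zw: "cmod (z - w) < d w" for z w
  proof -
    have cw: "c w \<ge> 0" "c z \<ge> 0" using c z w by auto
    have "cmod (z - w) * (g * c w) \<le> d w * (g * c w)"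
      using zw g cw by (intro mult_right_mono) auto
    also have "\<dots> \<le> 1 / 2"
    proof -
      have "2 * g * (c w + 1) > 0" using g cw by (intro mult_pos_pos) auto
      then show ?thesis using g by (simp add: d_def pos_divide_le_eq algebra_simps)
    qed
    finally have half: "cmod (z - w) * (g * c w) \<le> 1 / 2" .
    have "norm (S z v) \<le> (c w + c z / 2) * norm v" for v
    proof -
      have "norm (S z v) \<le> norm (S w v) + norm (S z v - S w v)"
        by (simp add: norm_triangle_sub)
      also have "norm (S z v - S w v) \<le> cmod (z - w) * (c z * (g * (c w * norm v)))"
        unfolding resolvent[OF z w] norm_scaleC
        using c(2)[OF z, of "G (S w v)"] g(2)[of "S w v"] c(2)[OF w, of v] cw g(1)
        by (intro mult_left_mono order_trans[OF c(2)[OF z]] order_trans[OF g(2)]) auto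
      also have "\<dots> = (cmod (z - w) * (g * c w)) * (c z * norm v)" by simp
      also have "\<dots> \<le> 1 / 2 * (c z * norm v)" using half cw by (intro mult_right_mono) auto
      finally show ?thesis using c(2)[OF w, of v] by (simp add: algebra_simps)
    qed
    then have "onorm (S z) \<le> c w + c z / 2" using cw by (intro onorm_bound) auto
    then have "c z \<le> c w + c z / 2" by (simp add: c_def)
    then show ?thesis by simp
  qed
  have d: "d w > 0" if "cmod w \<le> r" for w
    using g c(1)[OF that] by (simp add: d_def)
  obtain C where C: "C \<subseteq> cball 0 r" "finite C" "cball 0 r \<subseteq> (\<Union>w\<in>C. ball w (d w))"
  proof (rule compactE_image[of "cball 0 r" "cball 0 r" "\<lambda>w. ball w (d w)"])
    show "cball 0 r \<subseteq> (\<Union>w\<in>cball 0 r. ball w (d w))" using d by auto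
  qed auto
  define K where "K = (\<Sum>w\<in>C. 2 * c w)"
  have Cr: "cmod w \<le> r" if "w \<in> C" for w using that C(1) by auto
  have K0: "K \<ge> 0" unfolding K_def using c(1) Cr by (intro sum_nonneg) auto
  have cK: "c z \<le> K" if z: "cmod z \<le> r" for z
  proof -
    have "z \<in> cball 0 r" using z by simp
    then obtain w where w: "w \<in> C" "z \<in> ball w (d w)" using C(3) by blast
    have "c z \<le> 2 * c w"
      using w z Cr[of w] by (intro local_bound) (auto simp: dist_norm norm_minus_commute)
    also have "\<dots> \<le> K"
      unfolding K_def using w(1) C(2) c(1) Cr by (intro member_le_sum) auto
    finally show ?thesis .
  qed
  have SK: "norm (S z v) \<le> K * norm v" if "cmod z \<le> r" for z v
    using c(2)[OF that, of v] mult_right_mono[OF cK[OF that], of "norm v"] by simp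
  have main: "norm ((G ^^ n) v) * r ^ n \<le> K * norm v" for n v
  proof -
    obtain F :: "'a cdual" where F: "norm F \<le> 1" "cdual_apply F ((G ^^ n) v) = norm ((G ^^ n) v)"
      using norming_functional by blast
    have F1: "cmod (cdual_apply F u) \<le> norm u" for u
      using cdual_bound[of F u] mult_right_mono[OF F(1), of "norm u"] by simp
    define h where "h u z = cdual_apply F (S z u)" for u z
    have hdiff: "h u z - h u w = (z - w) * h (G (S w u)) z" if "cmod z \<le> r" "cmod w \<le> r" for u z w
      unfolding h_def using resolvent[OF that, of u]
      by (metis cdual_apply_scaleC linear_diff[OF linear_cdual_apply])
    have hb: "cmod (h u z) \<le> K * norm u" if "cmod z \<le> r" for u z
      unfolding h_def using F1[of "S z u"] SK[OF that, of u] by simp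
    have lip: "cmod (h u z - h u w) \<le> K * g * K * norm u * cmod (z - w)" if "cmod z \<le> r" "cmod w \<le> r" for u z w
    proof -
      have "cmod (h u z - h u w) \<le> cmod (z - w) * (K * (g * (K * norm u)))"
        unfolding hdiff[OF that] norm_mult using K0 g
        by (intro mult_left_mono order_trans[OF hb[OF that(1)]] order_trans[OF g(2)] SK[OF that(2)]) auto
      then show ?thesis by (simp add: mult_ac)
    qed
    have cont: "continuous_on (cball 0 r) (h u)" for u
    proof (rule lipschitz_on_continuous_on)
      show "(K * g * K * norm u)-lipschitz_on (cball 0 r) (h u)"
        using K0 g lip by (intro lipschitz_onI) (auto simp: dist_norm)
    qed
    have deriv: "(h u has_field_derivative h (G (S w u)) w) (at w)" if w: "w \<in> ball 0 r" for u w
    proof -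
      have "isCont (h (G (S w u))) w"
        using cont[of "G (S w u)"] w by (simp add: continuous_on_interior interior_cball)
      then have "((\<lambda>z. h (G (S w u)) z) \<longlongrightarrow> h (G (S w u)) w) (at w)" by (simp add: isCont_def)
      moreover have "\<forall>\<^sub>F z in at w. h (G (S w u)) z = (h u z - h u w) / (z - w)"
        unfolding eventually_at_topological
        using w hdiff[of _ w u] by (intro exI[of _ "ball 0 r"]) simp
      ultimately have "((\<lambda>z. (h u z - h u w) / (z - w)) \<longlongrightarrow> h (G (S w u)) w) (at w)"
        by (rule Lim_transform_eventually)
      then show ?thesis by (simp add: has_field_derivative_iff)
    qed
    have holo: "h v holomorphic_on ball 0 r"
    proof (rule holomorphic_onI)
      fix w :: complex assume "w \<in> ball 0 r"
      from has_field_derivative_at_within[OF deriv[OF this]]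
      show "h v field_differentiable at w within ball 0 r" unfolding field_differentiable_def by (rule exI)
    qed
    \<comment> \<open>near \<open>0\<close> the resolvent is a geometric series, which identifies the Taylor coefficients\<close>
    have "(h v) has_fps_expansion (Abs_fps (\<lambda>n. cdual_apply F ((G ^^ n) v)))"
    proof -
      define a where "a n = cdual_apply F ((G ^^ n) v)" for n
      have an: "cmod (cdual_apply F ((G ^^ n) u)) \<le> g ^ n * norm u" for n u
      proof -
        have "norm ((G ^^ n) u) \<le> g ^ n * norm u"
        proof (induction n)
          case (Suc n)
          then have "g * norm ((G ^^ n) u) \<le> g * (g ^ n * norm u)" using g by (intro mult_left_mono) auto
          then show ?case using g(2)[of "(G ^^ n) u"] by simp
        qed simp
        then show ?thesis using F1 order_trans by blast
      qed
      have sums: "(\<lambda>n. a n * z ^ n) sums h v z" if z: "cmod z \<le> r" "cmod z < 1 / g" for z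
      proof -
        have part: "(\<Sum>k<n. a k * z ^ k) = h v z - z ^ n * cdual_apply F ((G ^^ n) (S z v))" for n
        proof (induction n)
          case 0 then show ?case by (simp add: h_def)
        next
          case (Suc n)
          have Gn: "bounded_clinear (G ^^ n)" by (rule bounded_clinear_funpow[OF G])
          have "(G ^^ n) (S z v) = (G ^^ n) (v + z *\<^sub>C G (S z v))"
            using S(3)[OF z(1), of v] by (simp add: algebra_simps)
          also have "\<dots> = (G ^^ n) v + z *\<^sub>C (G ^^ Suc n) (S z v)"
            by (simp add: bounded_clinear_add[OF Gn] bounded_clinear_scaleC[OF Gn] funpow_swap1)
          finally have "cdual_apply F ((G ^^ n) (S z v)) = a n + z * cdual_apply F ((G ^^ Suc n) (S z v))"
            by (simp only: a_def linear_add[OF linear_cdual_apply] cdual_apply_scaleC)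
          then show ?case unfolding sum.lessThan_Suc Suc power_Suc by (simp only: algebra_simps)
        qed
        have "(\<lambda>n. z ^ n * cdual_apply F ((G ^^ n) (S z v))) \<longlonglongrightarrow> 0"
        proof (rule Lim_null_comparison)
          show "\<forall>\<^sub>F n in sequentially. norm (z ^ n * cdual_apply F ((G ^^ n) (S z v))) \<le> (cmod z * g) ^ n * norm (S z v)"
            using an[of _ "S z v"] by (intro always_eventually allI)
              (simp add: norm_mult norm_power power_mult_distrib mult.assoc mult_left_mono)
          have "(\<lambda>n. (cmod z * g) ^ n) \<longlonglongrightarrow> 0"
            using z(2) g by (intro LIMSEQ_power_zero) (simp add: field_simps)
          then show "(\<lambda>n. (cmod z * g) ^ n * norm (S z v)) \<longlonglongrightarrow> 0" by (rule tendsto_mult_left_zero)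
        qed
        then have "(\<lambda>n. h v z - z ^ n * cdual_apply F ((G ^^ n) (S z v))) \<longlonglongrightarrow> h v z - 0"
          by (intro tendsto_intros)
        then show ?thesis unfolding sums_def part by simp
      qed
      define s where "s = min r (1 / (2 * g))"
      have s: "s > 0" "s \<le> r" "s < 1 / g" using r g by (auto simp: s_def min_def field_simps)
      have "conv_radius a \<ge> norm (complex_of_real s)"
        using sums[of "complex_of_real s"] s by (intro conv_radius_geI) (auto simp: sums_iff)
      moreover have "0 < ereal (norm (complex_of_real s))" using s by simp
      ultimately have "0 < conv_radius a" by (rule order.strict_trans2[rotated])
      then have "fps_conv_radius (Abs_fps a) > 0" by (simp add: fps_conv_radius_def fps_nth_Abs_fps[abs_def])
      moreover have "eventually (\<lambda>z. eval_fps (Abs_fps a) z = h v z) (nhds 0)"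
        unfolding eventually_nhds
        using s sums by (intro exI[of _ "ball 0 s"]) (auto simp: eval_fps_def sums_iff)
      ultimately show ?thesis unfolding has_fps_expansion_def a_def by blast
    qed
    then have coeff: "cdual_apply F ((G ^^ n) v) = (deriv ^^ n) (h v) 0 / fact n"
      using fps_nth_fps_expansion by fastforce
    have "cmod ((deriv ^^ n) (h v) 0) \<le> fact n * (K * norm v) / r ^ n"
      by (rule Cauchy_inequality[OF holo cont r]) (use hb in auto)
    moreover have "norm ((G ^^ n) v) = cmod (cdual_apply F ((G ^^ n) v))" unfolding F(2) by simp
    ultimately have "norm ((G ^^ n) v) \<le> (K * norm v) / r ^ n"
      unfolding coeff by (simp add: norm_divide pos_divide_le_eq mult.commute)
    then show ?thesis using r by (simp add: pos_le_divide_eq)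
  qed
  show ?thesis using K0 main by blast
qed

section \<open>The norm of odd polynomials in a unit vector\<close>

lemma inverts_compose:
  assumes "inverts R A" "inverts S B"
  shows "inverts (\<lambda>v. S (R v)) (\<lambda>v. A (B v))"
  using assms by (simp add: inverts_def bounded_clinear_compose)

lemma inverts_scaleC:
  fixes c :: complex
  assumes "c \<noteq> 0"
  shows "inverts (\<lambda>v. inverse c *\<^sub>C (v::'a::complex_normed_vector)) (\<lambda>v. c *\<^sub>C v)"
  using assms bounded_clinear_scaleC_compose[OF bounded_clinear_ident]
  by (simp add: inverts_def scaleC_scaleC scaleC_one)

text \<open>
  Solving \<open>T u - w u = v\<close> means finding a fixed point of a contraction.
\<close>

lemma inverts_shift_large:
  fixes T :: "'a::complex_banach \<Rightarrow> 'a"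
  assumes T: "bounded_clinear T" and k: "\<And>v. norm (T v) \<le> k * norm v" "0 \<le> k" "k < cmod w"
  shows "\<exists>S. inverts S (\<lambda>v. T v - w *\<^sub>C v)"
proof -
  define P where "P v u = inverse w *\<^sub>C (T u - v)" for v u
  have w: "w \<noteq> 0" using k by auto
  have P: "P v u = u \<longleftrightarrow> T u - w *\<^sub>C u = v" for u v
  proof
    assume "P v u = u"
    then have "w *\<^sub>C u = w *\<^sub>C inverse w *\<^sub>C (T u - v)" by (simp add: P_def)
    then show "T u - w *\<^sub>C u = v" using w by (simp add: scaleC_scaleC scaleC_one)
  next
    assume "T u - w *\<^sub>C u = v"
    then have "T u - v = w *\<^sub>C u" by auto
    then show "P v u = u" using w by (simp add: P_def scaleC_scaleC scaleC_one)
  qed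
  have "\<exists>!u. P v u = u" for v
  proof (rule banach_fix_type)
    show "0 \<le> k / cmod w" "k / cmod w < 1" using k by (simp_all add: divide_less_eq)
    show "\<forall>y z. dist (P v y) (P v z) \<le> k / cmod w * dist y z"
    proof (intro allI)
      fix y z
      have "P v y - P v z = inverse w *\<^sub>C (T (y - z))"
        by (simp add: P_def bounded_clinear_diff[OF T] flip: scaleC_diff_right)
      then show "dist (P v y) (P v z) \<le> k / cmod w * dist y z"
        using mult_left_mono[OF k(1)[of "y - z"], of "inverse (cmod w)"]
        by (simp add: dist_norm norm_scaleC norm_inverse divide_inverse mult_ac)
    qed
  qed
  then have ex: "\<exists>!u. T u - w *\<^sub>C u = v" for v by (simp add: P)
  define S where "S v = (THE u. T u - w *\<^sub>C u = v)" for v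
  have S: "T (S v) - w *\<^sub>C S v = v" for v unfolding S_def by (rule theI'[OF ex])
  have uniq: "S v = u" if "T u - w *\<^sub>C u = v" for u v using ex[of v] S[of v] that by blast
  have "bounded_clinear S"
  proof (rule bounded_clinearI)
    show "S (u + v) = S u + S v" for u v
      using S[of u] S[of v] by (intro uniq) (simp add: bounded_clinear_add[OF T] scaleC_add_right algebra_simps)
    show "S (c *\<^sub>C v) = c *\<^sub>C S v" for c v
    proof (rule uniq)
      have "T (c *\<^sub>C S v) - w *\<^sub>C c *\<^sub>C S v = c *\<^sub>C (T (S v) - w *\<^sub>C S v)"
        by (simp add: bounded_clinear_scaleC[OF T] scaleC_diff_right scaleC_scaleC mult.commute)
      then show "T (c *\<^sub>C S v) - w *\<^sub>C c *\<^sub>C S v = c *\<^sub>C v" by (simp add: S)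
    qed
    show "norm (S v) \<le> norm v * (1 / (cmod w - k))" for v
    proof -
      have "cmod w * norm (S v) = norm (T (S v) - v)"
        using S[of v] by (metis norm_scaleC add_diff_cancel_left' diff_add_cancel)
      also have "\<dots> \<le> k * norm (S v) + norm v"
        using norm_triangle_ineq4[of "T (S v)" v] k(1)[of "S v"] by linarith
      finally show ?thesis using k by (simp add: field_simps)
    qed
  qed
  then show ?thesis using S uniq by (auto simp: inverts_def)
qed

lemma polynomial_action_scaleC:
  assumes "bounded_clinear (T :: 'a::complex_normed_vector \<Rightarrow> 'a)"
  shows "polynomial_action (\<lambda>c v. c *\<^sub>C v) T"
  by standard (simp_all add: scaleC_add_right scaleC_add_left scaleC_scaleC scaleC_one
      bounded_clinear_add[OF assms] bounded_clinear_scaleC[OF assms])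

context
  fixes T :: "'a::complex_banach \<Rightarrow> 'a"
  assumes T: "bounded_clinear T"
begin

interpretation cx: polynomial_action "\<lambda>c v. c *\<^sub>C (v::'a)" T
  by (rule polynomial_action_scaleC[OF T])

lemma bounded_clinear_act: "bounded_clinear (cx.act p)"
proof (induction p)
  case 0
  then show ?case by (intro bounded_clinearI[where K = 0]) (simp_all add: cx.scale_right_distrib)
next
  case (pCons a p)
  have "bounded_clinear (\<lambda>v. a *\<^sub>C v + T (cx.act p v))"
    by (intro bounded_clinear_add_compose bounded_clinear_scaleC_compose bounded_clinear_ident
        bounded_clinear_compose[OF T] pCons)
  then show ?case by (simp add: cx.act_pCons[abs_def])
qed

text \<open>
  Half of the spectral mapping theorem: the polynomial splits into linear
  factors, each of which is invertible at \<open>T\<close>.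
\<close>

lemma inverts_polynomial:
  assumes "p \<noteq> 0" and "\<And>w. poly p w = 0 \<Longrightarrow> \<exists>S. inverts S (\<lambda>v. T v - w *\<^sub>C v)"
  shows "\<exists>S. inverts S (cx.act p)"
  using assms
proof (induction "degree p" arbitrary: p rule: less_induct)
  case less
  show ?case
  proof (cases "degree p = 0")
    case True
    then obtain a where p: "p = [:a:]" by (rule degree_eq_zeroE)
    then have "a \<noteq> 0" using less by auto
    moreover have "cx.act p = (\<lambda>v. a *\<^sub>C v)" by (rule ext) (simp add: p cx.T_0)
    ultimately show ?thesis using inverts_scaleC[of a] by auto
  next
    case False
    then have "\<not> constant (poly p)" by (simp add: constant_degree)
    then obtain w where w: "poly p w = 0" using fundamental_theorem_of_algebra by blast
    then obtain q where q: "p = [:- w, 1:] * q" by (auto simp: poly_eq_0_iff_dvd)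
    then have q0: "q \<noteq> 0" using less by auto
    have "degree p = Suc (degree q)" unfolding q using q0 by (subst degree_mult_eq) auto
    then obtain S where S: "inverts S (cx.act q)" using less(1)[of q] q0 less(3) q by auto
    obtain R where R: "inverts R (\<lambda>v. T v - w *\<^sub>C v)" using less(3)[OF w] by blast
    have e: "cx.act p = (\<lambda>v. T (cx.act q v) - w *\<^sub>C cx.act q v)"
      unfolding q by (rule ext) (simp only: cx.act_mult, simp add: cx.T_0)
    show ?thesis unfolding e using inverts_compose[OF R S] by blast
  qed
qed

lemma act_of_real:
  assumes "polynomial_action (scaleR :: real \<Rightarrow> 'a \<Rightarrow> 'a) T"
  shows "cx.act (map_poly of_real p) v = polynomial_action.act scaleR T p v"
proof -
  interpret re: polynomial_action "scaleR :: real \<Rightarrow> 'a \<Rightarrow> 'a" T by fact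
  show ?thesis by (induction p) (simp_all add: map_poly_pCons flip: scaleR_scaleC)
qed

text \<open>
  For \<open>\<bar>z\<bar> \<le> 1 / b\<close> the polynomial \<open>1 - z g\<close> has no root in \<open>[0, M]\<close>, hence none in the spectrum of
  \<open>T\<close>, and \<open>power_bound_of_resolvent\<close> applies to \<open>g(T)\<close>.
\<close>

lemma polynomial_power_bound:
  assumes re: "polynomial_action (scaleR :: real \<Rightarrow> 'a \<Rightarrow> 'a) T"
    and M: "\<And>v. norm (T v) \<le> M * norm v" "M \<ge> 0"
    and spec: "op_spectrum T \<subseteq> complex_of_real ` {0..}"
    and b: "\<And>t. 0 \<le> t \<Longrightarrow> t \<le> M \<Longrightarrow> \<bar>poly g t\<bar> < b" "b > 0"
  shows "\<exists>K\<ge>0. \<forall>n v. norm (polynomial_action.act scaleR T (g ^ n) v) \<le> K * norm v * b ^ n"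
proof -
  interpret re: polynomial_action "scaleR :: real \<Rightarrow> 'a \<Rightarrow> 'a" T by fact
  define h where "h = map_poly complex_of_real g"
  have poly_h: "poly h (of_real t) = of_real (poly g t)" for t
    unfolding h_def by (induction g) (simp_all add: map_poly_pCons)
  have "\<exists>K\<ge>0. \<forall>n v. norm ((cx.act h ^^ n) v) * (1 / b) ^ n \<le> K * norm v"
  proof (rule power_bound_of_resolvent[OF bounded_clinear_act])
    show "1 / b > 0" using b by simp
    fix z :: complex assume z: "cmod z \<le> 1 / b"
    define q where "q = 1 - smult z h"
    have qt: "poly q (of_real t) \<noteq> 0" if "0 \<le> t" "t \<le> M" for t
    proof
      assume "poly q (of_real t) = 0"
      then have "z * of_real (poly g t) = 1" by (simp add: q_def poly_h)
      then have "cmod z * \<bar>poly g t\<bar> = 1" by (metis norm_mult norm_of_real norm_one)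
      moreover have "cmod z * \<bar>poly g t\<bar> \<le> 1 / b * \<bar>poly g t\<bar>" using z by (intro mult_right_mono) auto
      ultimately show False using b(1)[OF that] b(2) by (simp add: field_simps)
    qed
    have "q \<noteq> 0" using qt[of 0] M by auto
    then have "\<exists>S. inverts S (cx.act q)"
    proof (rule inverts_polynomial)
      fix w assume w: "poly q w = 0"
      show "\<exists>S. inverts S (\<lambda>v. T v - w *\<^sub>C v)"
      proof (cases "w \<in> op_spectrum T")
        case True
        then obtain t where t: "w = of_real t" "t \<ge> 0" using spec by auto
        then have "t > M" using qt[of t] w by force
        then show ?thesis using t M by (intro inverts_shift_large[OF T M]) auto
      next
        case False
        then show ?thesis by (auto simp: op_spectrum_def inverts_def)
      qed
    qed
    moreover have "cx.act q = (\<lambda>v. v - z *\<^sub>C cx.act h v)"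
      by (rule ext) (simp add: q_def cx.act_diff cx.act_smult)
    ultimately show "\<exists>S. inverts S (\<lambda>v. v - z *\<^sub>C cx.act h v)" by simp
  qed
  moreover have "cx.act h = re.act g"
    unfolding h_def by (rule ext) (rule act_of_real[OF re])
  ultimately obtain K where K: "K \<ge> 0" "\<And>n v. norm ((re.act g ^^ n) v) * (1 / b) ^ n \<le> K * norm v"
    by auto
  then have "norm (re.act (g ^ n) v) \<le> K * norm v * b ^ n" for n v
    using b(2) K(2)[of n v] by (simp add: re.act_power power_divide field_simps)
  then show ?thesis using K(1) by blast
qed

end

context jb_unit_vector
begin

lemma bounded_clinear_T: "bounded_clinear T"
  using hermitian[of x] by (simp add: hermitian_op_def)

lemma T_bounded: "\<exists>M\<ge>1. \<forall>v. norm (T v) \<le> M * norm v"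
  using triple_bounded unit by (metis mult.right_neutral)

text \<open>
  Iterated cubes of \<open>p\<close> are \<open>g\<^sup>n p\<close> with \<open>g = t p\<^sup>2\<close>, so that \<open>(N p)\<^sup>2\<close> is at most the growth rate of
  the powers of \<open>g(T)\<close>.
\<close>

lemma N_le_global:
  assumes M: "\<And>v. norm (T v) \<le> M * norm v" "M \<ge> 1"
    and b: "\<And>t. 0 \<le> t \<Longrightarrow> t \<le> M \<Longrightarrow> t * (poly p t)\<^sup>2 \<le> b\<^sup>2" "b \<ge> 0"
  shows "N p \<le> b"
proof -
  have "(N p)\<^sup>2 \<le> c" if c: "c > b\<^sup>2" for c
  proof -
    have c0: "c > 0" using c zero_le_power2[of b] by linarith
    define g where "g = [:0, 1:] * p ^ 2"
    have "\<bar>poly g t\<bar> < c" if "0 \<le> t" "t \<le> M" for t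
      using b(1)[OF that] c that by (simp add: g_def abs_mult)
    then obtain K where K: "K \<ge> 0" "\<And>n v. norm (re.act (g ^ n) v) \<le> K * norm v * c ^ n"
      using polynomial_power_bound[OF bounded_clinear_T re.polynomial_action_axioms M(1) _ spectrum_nonneg[of x], of g c] M(2) c0
      by auto
    show ?thesis
    proof (rule le_if_cubic_powers_le)
      fix k :: nat
      define n :: nat where "n = (3 ^ k - 1) div 2"
      have "odd ((3::nat) ^ k)" by simp
      then obtain m where "(3::nat) ^ k = 2 * m + 1" by (rule oddE)
      then have n: "3 ^ k = Suc (2 * n)" by (simp add: n_def)
      have "N p ^ (3 ^ k) = N (g ^ n * p)"
        by (simp only: N_cube_poly[symmetric] cube_poly_eq n_def g_def)
      also have "\<dots> = norm (re.act (g ^ n) (re.act p x))" by (simp only: N_def re.act_mult)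
      also have "\<dots> \<le> K * N p * c ^ n" using K(2)[of n "re.act p x"] by (simp add: N_def)
      finally have "(N p ^ (3 ^ k))\<^sup>2 \<le> (K * N p * c ^ n)\<^sup>2" by (intro power_mono) (simp_all add: N_nonneg)
      also have "\<dots> = (K * N p)\<^sup>2 / c * c ^ (3 ^ k)"
        unfolding n power_Suc power_even_eq power_mult_distrib using c0 by simp
      finally show "(N p)\<^sup>2 ^ 3 ^ k \<le> (K * N p)\<^sup>2 / c * c ^ 3 ^ k"
        by (simp add: mult.commute flip: power_mult)
    qed (use c0 in auto)
  qed
  then have "(N p)\<^sup>2 \<le> b\<^sup>2" by (rule dense_ge)
  from power2_le_imp_le[OF this b(2)] show ?thesis .
qed

text \<open>
  The spectrum of \<open>D(x, x)\<close> on the whole space is only known to lie in some \<open>[0, M]\<close>. The part beyond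
  \<open>1\<close> is cut off by a polynomial \<open>v = 1 + e t\<^sup>k\<close>: multiplication by \<open>v\<close> costs at most the factor
  \<open>1 + e\<close>, because multiplication by \<open>t\<close> does not increase \<open>N\<close>, whereas \<open>1 / v\<close> is tiny beyond
  \<open>1 + d\<close>. A partial sum \<open>u\<close> of the geometric series for \<open>1 / v\<close> in powers of \<open>w = 1 - v / A\<close>
  replaces \<open>1 / v\<close> by a polynomial.
\<close>

theorem N_le:
  assumes b: "\<And>t. 0 \<le> t \<Longrightarrow> t \<le> 1 \<Longrightarrow> t * (poly p t)\<^sup>2 \<le> b\<^sup>2" "b \<ge> 0"
  shows "N p \<le> b"
proof -
  obtain M where M: "M \<ge> 1" "\<And>v. norm (T v) \<le> M * norm v" using T_bounded by blast
  define f where "f t = sqrt t * \<bar>poly p t\<bar>" for t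
  have f2: "t * (poly p t)\<^sup>2 = (f t)\<^sup>2" if "t \<ge> 0" for t
    using that by (simp add: f_def power_mult_distrib)
  have f0: "f t \<ge> 0" if "t \<ge> 0" for t using that by (simp add: f_def)
  have cont: "continuous_on A f" for A unfolding f_def by (intro continuous_intros)
  have fb: "f t \<le> b" if "0 \<le> t" "t \<le> 1" for t
    using b(1)[OF that] unfolding f2[OF that(1)] by (rule power2_le_imp_le) (rule b(2))
  obtain B where B: "\<And>t. 0 \<le> t \<Longrightarrow> t \<le> M \<Longrightarrow> f t \<le> B"
  proof -
    have "bounded (f ` {0..M})" by (intro compact_imp_bounded compact_continuous_image cont) simp
    then obtain B where B: "norm y \<le> B" if "y \<in> f ` {0..M}" for y by (auto simp: bounded_iff)
    have "f t \<le> B" if "0 \<le> t" "t \<le> M" for t using B[of "f t"] that by auto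
    then show ?thesis by (rule that)
  qed
  have B0: "B \<ge> 0" using B[of 0] f0[of 0] M by simp
  have step: "N p \<le> (1 + e) * (b + e)" if e: "e > 0" for e
  proof -
    obtain d where d: "d > 0" "\<And>t. \<bar>t - 1\<bar> < d \<Longrightarrow> f t < b + e"
    proof -
      have "isCont f 1" using cont[of UNIV] by (simp add: continuous_on_eq_continuous_at)
      then obtain d where d: "d > 0" "\<And>t. dist t 1 < d \<Longrightarrow> dist (f t) (f 1) < e"
        unfolding continuous_at_eps_delta using e by blast
      have "f t < b + e" if "\<bar>t - 1\<bar> < d" for t
        using d(2)[of t] that fb[of 1] by (auto simp: dist_real_def)
      then show ?thesis by (rule that[OF d(1)])
    qed
    have be: "b + e > 0" using b e by simp
    obtain k where k: "B / (e * (b + e)) < (1 + d) ^ k"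
      using real_arch_pow[of "1 + d" "B / (e * (b + e))"] d by auto
    \<comment> \<open>\<open>v\<close> is nearly \<open>1\<close> on \<open>[0, 1]\<close> and large to the right of \<open>1 + d\<close>\<close>
    define v where "v = 1 + smult e ([:0, 1:] ^ k)"
    have pv: "poly v t = 1 + e * t ^ k" for t by (simp add: v_def poly_power)
    have v1: "poly v t \<ge> 1" if "t \<ge> 0" for t using that e by (simp add: pv)
    have fv: "f t \<le> (b + e) * poly v t" if t: "0 \<le> t" "t \<le> M" for t
    proof -
      consider "t \<le> 1" | "1 < t" "t < 1 + d" | "t \<ge> 1 + d" by linarith
      then show ?thesis
      proof cases
        case 3
        have "f t \<le> B" by (rule B[OF t])
        also have "\<dots> \<le> (e * (b + e)) * (1 + d) ^ k"
          using k e be by (simp add: pos_divide_less_eq mult.commute)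
        also have "\<dots> \<le> (e * (b + e)) * t ^ k" using 3 e d be by (intro mult_left_mono power_mono) auto
        also have "\<dots> \<le> (b + e) * poly v t" using be by (simp add: pv algebra_simps)
        finally show ?thesis .
      next
        case 1
        then have "f t \<le> (b + e) * 1" using fb[of t] t e by simp
        also have "\<dots> \<le> (b + e) * poly v t" using be v1[OF t(1)] by (intro mult_left_mono) auto
        finally show ?thesis .
      next
        case 2
        then have "f t \<le> (b + e) * 1" using d(2)[of t] by simp
        also have "\<dots> \<le> (b + e) * poly v t" using be v1[OF t(1)] by (intro mult_left_mono) auto
        finally show ?thesis .
      qed
    qed
    define A where "A = 1 + e * M ^ k"
    have A: "A \<ge> 1" using e M by (simp add: A_def)
    have vA: "poly v t \<le> A" if "0 \<le> t" "t \<le> M" for t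
      unfolding pv A_def using that e by (intro add_left_mono mult_left_mono power_mono) auto
    define w where "w = 1 - smult (1 / A) v"
    have pw: "poly w t = 1 - poly v t / A" for t by (simp add: w_def)
    have w0: "0 \<le> poly w t" "poly w t \<le> 1 - 1 / A" if "0 \<le> t" "t \<le> M" for t
      using vA[OF that] v1[OF that(1)] A by (simp_all add: pw field_simps)
    have main: "N p \<le> (1 + e) * (b + e) + B * (1 - 1 / A) ^ n" for n
    proof -
      define u where "u = smult (1 / A) (\<Sum>i<n. w ^ i)"
      have "1 - w ^ n = (1 - w) * (\<Sum>i<n. w ^ i)" by (rule one_diff_power_eq)
      also have "\<dots> = v * u" by (simp add: w_def u_def)
      finally have uv: "1 - w ^ n = v * u" .
      have pu: "poly v t * poly u t = 1 - poly w t ^ n" for t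
        using arg_cong[OF uv, of "\<lambda>q. poly q t"] by (simp add: poly_power)
      have "N (u * p) \<le> b + e"
      proof (rule N_le_global[OF M(2,1)])
        fix t assume t: "0 \<le> t" "t \<le> M"
        have vp: "poly v t > 0" using v1[OF t(1)] by simp
        have "1 / A \<ge> 0" using A by simp
        then have "poly w t \<le> 1" using w0(2)[OF t] by linarith
        then have "0 \<le> poly w t ^ n" "poly w t ^ n \<le> 1"
          using w0(1)[OF t] by (auto intro: power_le_one)
        then have vu: "0 \<le> poly v t * poly u t" "poly v t * poly u t \<le> 1" by (simp_all add: pu)
        then have u0: "0 \<le> poly u t" using vp by (simp add: zero_le_mult_iff)
        have "f t * poly u t \<le> ((b + e) * poly v t) * poly u t"
          using fv[OF t] u0 by (intro mult_right_mono)
        also have "\<dots> = (b + e) * (poly v t * poly u t)" by simp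
        also have "\<dots> \<le> (b + e) * 1" using vu be by (intro mult_left_mono) auto
        finally have "(f t * poly u t)\<^sup>2 \<le> (b + e)\<^sup>2" using f0[OF t(1)] u0 by (intro power_mono) auto
        moreover have "t * (poly (u * p) t)\<^sup>2 = (f t * poly u t)\<^sup>2"
          using f2[OF t(1)] by (simp add: power_mult_distrib mult_ac)
        ultimately show "t * (poly (u * p) t)\<^sup>2 \<le> (b + e)\<^sup>2" by simp
      qed (use be in simp)
      moreover have "N (v * (u * p)) \<le> (1 + e) * N (u * p)"
      proof -
        have "v * (u * p) = u * p + smult e ([:0, 1:] ^ k * (u * p))"
          by (simp only: v_def distrib_right mult_smult_left mult_1_left)
        then have "N (v * (u * p)) \<le> N (u * p) + e * N ([:0, 1:] ^ k * (u * p))"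
          using N_add[of "u * p" "smult e ([:0, 1:] ^ k * (u * p))"] N_smult[of e "[:0, 1:] ^ k * (u * p)"] e
          by simp
        also have "\<dots> \<le> N (u * p) + e * N (u * p)"
          using mult_left_mono[OF N_X_power_mult, of e] e by simp
        finally show ?thesis by (simp only: distrib_right mult_1_left)
      qed
      moreover have "N (w ^ n * p) \<le> B * (1 - 1 / A) ^ n"
      proof (rule N_le_global[OF M(2,1)])
        fix t assume t: "0 \<le> t" "t \<le> M"
        have "f t * poly w t ^ n \<le> B * (1 - 1 / A) ^ n"
          using B[OF t] w0[OF t] B0 by (intro mult_mono power_mono) auto
        then have "(f t * poly w t ^ n)\<^sup>2 \<le> (B * (1 - 1 / A) ^ n)\<^sup>2"
          using f0[OF t(1)] w0[OF t] by (intro power_mono) auto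
        moreover have "t * (poly (w ^ n * p) t)\<^sup>2 = (f t * poly w t ^ n)\<^sup>2"
          using f2[OF t(1)] by (simp add: power_mult_distrib poly_power mult_ac)
        ultimately show "t * (poly (w ^ n * p) t)\<^sup>2 \<le> (B * (1 - 1 / A) ^ n)\<^sup>2" by simp
      qed (use B0 A in simp)
      moreover have "p = v * (u * p) + w ^ n * p"
        using uv by (metis add.commute diff_add_cancel distrib_right mult.assoc mult_1_left)
      then have "N p \<le> N (v * (u * p)) + N (w ^ n * p)" using N_add by metis
      moreover have "(1 + e) * N (u * p) \<le> (1 + e) * (b + e)"
        using calculation(1) e by (intro mult_left_mono) auto
      ultimately show ?thesis by linarith
    qed
    have "(\<lambda>n. (1 + e) * (b + e) + B * (1 - 1 / A) ^ n) \<longlonglongrightarrow> (1 + e) * (b + e) + B * 0"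
      using A by (intro tendsto_intros LIMSEQ_power_zero) auto
    then have "(\<lambda>n. (1 + e) * (b + e) + B * (1 - 1 / A) ^ n) \<longlonglongrightarrow> (1 + e) * (b + e)" by simp
    then show ?thesis by (rule LIMSEQ_le_const) (use main in blast)
  qed
  show ?thesis
  proof (rule field_le_epsilon)
    fix c :: real assume c: "c > 0"
    define e where "e = min 1 (c / (2 + b))"
    have e: "e > 0" "e \<le> 1" "e \<le> c / (2 + b)"
      using c b(2) by (simp_all add: e_def)
    then have ec: "e * (2 + b) \<le> c" using b(2) by (simp add: pos_le_divide_eq)
    have "(1 + e) * (b + e) = b + e * (1 + b + e)" by (simp add: algebra_simps)
    also have "\<dots> \<le> b + e * (2 + b)" using e by (intro add_left_mono mult_left_mono) auto
    finally show "N p \<le> b + c" using step[OF e(1)] ec by linarith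
  qed
qed

end

section \<open>Convergence of the odd powers at a very smooth point\<close>

lemma power_gap_le:
  fixes t :: real
  assumes t: "0 \<le> t" "t \<le> 1"
  shows "t ^ m * (1 - t ^ n) \<le> n / Suc m"
proof -
  have "1 + real n * (t - 1) \<le> (1 + (t - 1)) ^ n" using t by (intro Bernoulli_inequality) simp
  then have 1: "1 - t ^ n \<le> n * (1 - t)" by (simp add: algebra_simps)
  have "real (card {..<Suc m}) * t ^ m \<le> (\<Sum>i<Suc m. t ^ i)"
    using t by (intro sum_bounded_below power_decreasing) auto
  then have "(1 - t) * (Suc m * t ^ m) \<le> (1 - t) * (\<Sum>i<Suc m. t ^ i)"
    using t by (intro mult_left_mono) auto
  also have "\<dots> = 1 - t ^ Suc m" by (rule one_diff_power_eq[symmetric])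
  also have "\<dots> \<le> 1" using t by simp
  finally have 2: "t ^ m * (1 - t) \<le> 1 / Suc m" by (simp add: pos_le_divide_eq mult_ac del: of_nat_Suc)
  have "t ^ m * (1 - t ^ n) \<le> t ^ m * (n * (1 - t))" using 1 t by (intro mult_left_mono) auto
  also have "\<dots> = n * (t ^ m * (1 - t))" by simp
  also have "\<dots> \<le> n * (1 / Suc m)" using 2 by (intro mult_left_mono) auto
  finally show ?thesis by simp
qed

context jb_unit_vector
begin

text \<open>
  Since \<open>T\<close> raises the degree by two, this is \<open>x\<^bsup>(2n+1)\<^esup>\<close>.
\<close>

definition odd_power :: "nat \<Rightarrow> 'a" where "odd_power n = (T ^^ n) x"

lemma odd_power_0: "odd_power 0 = x" by (simp add: odd_power_def)

lemma odd_power_triple: "triple (odd_power i) (odd_power j) (odd_power k) = odd_power (i + j + k + 1)"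
  unfolding odd_power_def by (rule triple_powers)

lemma act_X_power_x: "re.act ([:0, 1:] ^ n) x = odd_power n"
  by (simp add: re.act_X_power odd_power_def)

lemma norm_odd_power: "norm (odd_power n) = 1"
proof -
  have le: "N ([:0, 1:] ^ n) \<le> 1" for n using N_X_power_mult[of n 1] by (simp add: N_1)
  define m :: nat where "m = (3 ^ n - 1) div 2"
  have "2 * n + 1 \<le> 3 ^ n" by (induction n) auto
  then have nm: "n \<le> m" by (simp add: m_def)
  have "N (cube_poly n 1) = 1" by (simp add: N_cube_poly N_1)
  then have "1 = N ([:0, 1:] ^ m)" by (simp add: cube_poly_eq m_def)
  also have "\<dots> = N ([:0, 1:] ^ (m - n) * [:0, 1:] ^ n)" using nm by (simp flip: power_add)
  also have "\<dots> \<le> N ([:0, 1:] ^ n)" by (rule N_X_power_mult)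
  finally have "N ([:0, 1:] ^ n) = 1" using le[of n] by simp
  then show ?thesis by (simp add: N_def act_X_power_x)
qed

lemma norm_reflect: "norm (x - 2 *\<^sub>R odd_power m) \<le> 1"
proof -
  have "N (1 - smult 2 ([:0, 1:] ^ m)) \<le> 1"
  proof (rule N_le)
    fix t :: real assume t: "0 \<le> t" "t \<le> 1"
    have "0 \<le> t ^ m" "t ^ m \<le> 1" using t by (auto intro: power_le_one)
    then have "(1 - 2 * t ^ m)\<^sup>2 \<le> 1" by (simp add: abs_square_le_1 abs_le_iff)
    then have "t * (1 - 2 * t ^ m)\<^sup>2 \<le> 1 * 1" using t by (intro mult_mono) auto
    then show "t * (poly (1 - smult 2 ([:0, 1:] ^ m)) t)\<^sup>2 \<le> 1\<^sup>2" by (simp add: poly_power)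
  qed simp
  then show ?thesis by (simp only: N_def re.act_diff re.act_smult re.act_1 act_X_power_x)
qed

lemma norm_gap: "m \<le> j \<Longrightarrow> norm (x - odd_power m + odd_power j) \<le> 1"
proof -
  assume mj: "m \<le> j"
  have "N (1 - [:0, 1:] ^ m + [:0, 1:] ^ j) \<le> 1"
  proof (rule N_le)
    fix t :: real assume t: "0 \<le> t" "t \<le> 1"
    have "0 \<le> t ^ j" "t ^ j \<le> t ^ m" "t ^ m \<le> 1" using t mj by (auto intro: power_le_one power_decreasing)
    then have "(1 - t ^ m + t ^ j)\<^sup>2 \<le> 1" by (simp add: abs_square_le_1 abs_le_iff)
    then have "t * (1 - t ^ m + t ^ j)\<^sup>2 \<le> 1 * 1" using t by (intro mult_mono) auto
    then show "t * (poly (1 - [:0, 1:] ^ m + [:0, 1:] ^ j) t)\<^sup>2 \<le> 1\<^sup>2" by (simp add: poly_power)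
  qed simp
  then show ?thesis by (simp only: N_def re.act_diff re.act_add re.act_1 act_X_power_x)
qed

text \<open>
  With \<open>q = 1 - t\<^sup>m\<close> the assumption says \<open>N q \<le> \<rho>\<close>. The polynomial \<open>t\<^sup>j (1 - t\<^sup>n)\<close> splits into a multiple
  of \<open>t\<^sup>j q\<^bsup>2j+1\<^esup>\<close>, of norm at most \<open>2 \<rho>\<^bsup>2j+1\<^esup>\<close>, and a remainder with a factor \<open>t\<^sup>m (1 - t\<^sup>n)\<close>, which
  tends to \<open>0\<close> uniformly on \<open>[0, 1]\<close> as \<open>m\<close> grows.
\<close>

lemma powers_convergent_of_gap:
  assumes "\<rho> < 1" and gap: "\<And>m. m \<ge> m0 \<Longrightarrow> norm (x - odd_power m) \<le> \<rho>"
  shows "convergent odd_power"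
proof -
  have \<rho>0: "\<rho> \<ge> 0" using gap[of m0] norm_ge_zero[of "x - odd_power m0"] by linarith
  have main: "norm (odd_power j - odd_power (j + n)) \<le> 2 * \<rho> ^ (2 * j + 1)" for j n
  proof -
    define P :: "real poly" where "P = [:0, 1:] ^ j * (1 - [:0, 1:] ^ n)"
    define k where "k = 2 * j + 1"
    have "N P \<le> 2 * \<rho> ^ k + real k * (real n / Suc m)" if m: "m \<ge> m0" for m
    proof -
      define q :: "real poly" where "q = 1 - [:0, 1:] ^ m"
      define R where "R = [:0, 1:] ^ j * q ^ k"
      have "N q = norm (x - odd_power m)" by (simp only: q_def N_def re.act_diff re.act_1 act_X_power_x)
      then have "N q ^ k \<le> \<rho> ^ k" using gap[OF m] N_nonneg by (intro power_mono) auto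
      then have R: "N R \<le> \<rho> ^ k" using N_odd_power[of j q] unfolding R_def k_def by linarith
      have "(1 - [:0, 1:] ^ n) * R = R + smult (- 1) ([:0, 1:] ^ n * R)"
        by (simp add: left_diff_distrib)
      then have "N ((1 - [:0, 1:] ^ n) * R) \<le> N R + \<bar>- 1\<bar> * N ([:0, 1:] ^ n * R)"
        by (metis N_add N_smult)
      also have "\<dots> \<le> 2 * \<rho> ^ k" using N_X_power_mult[of n R] R by simp
      finally have first: "N ((1 - [:0, 1:] ^ n) * R) \<le> 2 * \<rho> ^ k" .
      have second: "N (P * (1 - q ^ k)) \<le> real k * (real n / Suc m)"
      proof (rule N_le)
        fix t :: real assume t: "0 \<le> t" "t \<le> 1"
        have tm: "0 \<le> t ^ m" "t ^ m \<le> 1" and tn: "0 \<le> t ^ n" "t ^ n \<le> 1" and tj: "0 \<le> t ^ j" "t ^ j \<le> 1"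
          using t by (auto intro: power_le_one)
        have "1 + real k * (- (t ^ m)) \<le> (1 + (- (t ^ m))) ^ k" using tm by (intro Bernoulli_inequality) auto
        then have b: "1 - (1 - t ^ m) ^ k \<le> k * t ^ m" by simp
        have b0: "0 \<le> 1 - (1 - t ^ m) ^ k" using tm by (simp add: power_le_one)
        have "t ^ j * (1 - t ^ n) * (1 - (1 - t ^ m) ^ k) \<le> 1 * (1 - t ^ n) * (k * t ^ m)"
          using tj tn b b0 tm by (intro mult_mono mult_nonneg_nonneg) auto
        also have "\<dots> = k * (t ^ m * (1 - t ^ n))" by simp
        also have "\<dots> \<le> k * (n / Suc m)" by (intro mult_left_mono power_gap_le t) auto
        finally have le: "t ^ j * (1 - t ^ n) * (1 - (1 - t ^ m) ^ k) \<le> k * (n / Suc m)" .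
        have "0 \<le> t ^ j * (1 - t ^ n) * (1 - (1 - t ^ m) ^ k)" using tj tn b0 by simp
        then have "t * (t ^ j * (1 - t ^ n) * (1 - (1 - t ^ m) ^ k))\<^sup>2 \<le> 1 * (k * (n / Suc m))\<^sup>2"
          using t power_mono[OF le, of 2] by (intro mult_mono) auto
        then show "t * (poly (P * (1 - q ^ k)) t)\<^sup>2 \<le> (real k * (real n / Suc m))\<^sup>2"
          by (simp add: P_def q_def poly_power)
      qed simp
      have "P = (1 - [:0, 1:] ^ n) * R + P * (1 - q ^ k)"
        unfolding P_def R_def by (simp only: right_diff_distrib left_diff_distrib mult_1_left mult_1_right mult_ac)
      then have "N P \<le> N ((1 - [:0, 1:] ^ n) * R) + N (P * (1 - q ^ k))" using N_add by metis
      then show ?thesis using first second by linarith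
    qed
    moreover have "(\<lambda>m. 2 * \<rho> ^ k + real k * (real n / Suc m)) \<longlonglongrightarrow> 2 * \<rho> ^ k + real k * 0"
      by (intro tendsto_intros LIMSEQ_Suc lim_const_over_n)
    ultimately have "N P \<le> 2 * \<rho> ^ k + real k * 0"
      using LIMSEQ_le_const[of "\<lambda>m. 2 * \<rho> ^ k + real k * (real n / Suc m)" "2 * \<rho> ^ k + real k * 0" "N P"]
      by blast
    moreover have "P = [:0, 1:] ^ j - [:0, 1:] ^ (j + n)"
      unfolding P_def by (simp only: power_add right_diff_distrib mult_1_right)
    ultimately show ?thesis by (simp add: N_def re.act_diff act_X_power_x k_def)
  qed
  have "Cauchy odd_power"
  proof (rule CauchyI')
    fix e :: real assume e: "e > 0"
    obtain J where J: "\<rho> ^ J < e / 2" using real_arch_pow_inv[of "e / 2" \<rho>] e assms(1) by auto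
    have "dist (odd_power m) (odd_power n) < e" if "m \<ge> J" "n > m" for m n
    proof -
      have "\<rho> ^ (2 * m + 1) \<le> \<rho> ^ J" using that \<rho>0 assms(1) by (intro power_decreasing) auto
      then show ?thesis using main[of m "n - m"] that J by (simp add: dist_norm)
    qed
    then show "\<exists>J. \<forall>m\<ge>J. \<forall>n>m. dist (odd_power m) (odd_power n) < e" by blast
  qed
  then show ?thesis by (simp add: Cauchy_convergent_iff)
qed

text \<open>
  Otherwise there are arbitrarily large \<open>m\<close> with \<open>\<parallel>x - odd_power m\<parallel>\<close> close to \<open>1\<close>. A functional \<open>\<phi>\<close>
  norming such a difference is close to \<open>1\<close> at \<open>x\<close> by \<open>norm_reflect\<close> and has real part almost at most
  \<open>0\<close> at all higher powers by \<open>norm_gap\<close>. The support functional of \<open>x\<close>, however, is \<open>1\<close> at every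
  power, because a functional norming a power also supports \<open>x\<close>.
\<close>

lemma powers_convergent:
  assumes vs: "very_smooth_point x"
  shows "convergent odd_power"
proof (rule ccontr)
  assume nc: "\<not> convergent odd_power"
  have "\<exists>m\<ge>k. norm (x - odd_power m) > 1 - 1 / Suc k" for k
    using powers_convergent_of_gap[of "1 - 1 / Suc k" k] nc by (force simp: not_less)
  then obtain m where m: "\<And>k. m k \<ge> k" "\<And>k. norm (x - odd_power (m k)) > 1 - 1 / Suc k" by metis
  have "\<exists>F. norm F \<le> 1 \<and> cdual_apply F (x - odd_power (m k)) = norm (x - odd_power (m k))" for k
    using norming_functional by blast
  then obtain \<phi> where \<phi>: "\<And>k. norm (\<phi> k) \<le> 1"
    "\<And>k. cdual_apply (\<phi> k) (x - odd_power (m k)) = norm (x - odd_power (m k))" by metis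
  obtain f where f: "norm f \<le> 1" "cdual_apply f x = 1"
    using norming_functional[of x] unit by auto
  have Re_le: "Re (cdual_apply F v) \<le> 1" if "norm F \<le> 1" "norm v \<le> 1" for F :: "'a cdual" and v
    using complex_Re_le_cmod[of "cdual_apply F v"] cdual_bound[of F v] mult_mono[OF that] by simp
  note lin = linear_add[OF linear_cdual_apply] linear_diff[OF linear_cdual_apply]
    linear_scale[OF linear_cdual_apply]
  have gap: "Re (cdual_apply (\<phi> k) x) - Re (cdual_apply (\<phi> k) (odd_power (m k))) > 1 - 1 / Suc k" for k
    using \<phi>(2)[of k] m(2)[of k] by (simp add: lin complex_eq_iff)
  show False
  proof (rule very_smooth_iterated_limit[OF vs f \<phi>(1), where \<epsilon> = "\<lambda>k. 2 / Suc k" and y = odd_power])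
    show "(\<lambda>k. 2 / real (Suc k)) \<longlonglongrightarrow> 0" by (intro LIMSEQ_Suc lim_const_over_n)
  next
    fix k
    have "Re (cdual_apply (\<phi> k) (x - 2 *\<^sub>R odd_power (m k))) \<le> 1" by (intro Re_le \<phi> norm_reflect)
    then show "1 - 2 / real (Suc k) \<le> Re (cdual_apply (\<phi> k) x)"
      using gap[of k] by (simp add: lin)
    show "\<forall>\<^sub>F j in sequentially. Re (cdual_apply (\<phi> k) (odd_power j)) \<le> 2 / real (Suc k)"
      using eventually_ge_at_top[of "m k"]
    proof eventually_elim
      case (elim j)
      have "Re (cdual_apply (\<phi> k) (x - odd_power (m k) + odd_power j)) \<le> 1" by (intro Re_le \<phi> norm_gap elim)
      then have "Re (cdual_apply (\<phi> k) (odd_power j)) \<le> 1 / Suc k" using gap[of k] by (simp add: lin)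
      also have "\<dots> \<le> 2 / Suc k" by (intro divide_right_mono) auto
      finally show ?case .
    qed
  next
    fix j
    show "norm (odd_power j) \<le> 1" by (simp add: norm_odd_power)
    obtain g where g: "norm g \<le> 1" "cdual_apply g (odd_power j) = 1"
      using norming_functional[of "odd_power j"] by (auto simp: norm_odd_power)
    have "norm (2 *\<^sub>R odd_power j - x) \<le> 1" using norm_reflect[of j] by (simp add: norm_minus_commute)
    then have "Re (cdual_apply g (2 *\<^sub>R odd_power j - x)) \<le> 1" by (intro Re_le g)
    then have "Re (cdual_apply g x) \<ge> 1" using g(2) by (simp add: lin)
    moreover have "cmod (cdual_apply g x) \<le> 1" using cdual_bound[of g x] g(1) unit by simp
    ultimately have "cdual_apply g x = 1" using eq_of_real_if_Re_ge[of 1] by simp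
    then have "g = f" by (intro very_smooth_unique_support[OF vs f g(1)])
    then show "1 \<le> Re (cdual_apply f (odd_power j))" using g(2) by simp
  qed
qed

end

section \<open>The norm near a tripotent\<close>

text \<open>
  Some functional touches the directional derivative of the norm at \<open>e\<close> in the direction \<open>b\<close>. It
  supports \<open>e\<close>, hence it is \<open>f\<close>. The scales \<open>3\<^bsup>-n\<^esup>\<close> are those on which the cube map is iterated.
\<close>

lemma difference_quotient_le_of_unique_support:
  fixes e b :: "'a::complex_normed_vector"
  assumes e: "norm e = 1"
    and uniq: "\<And>g. norm g \<le> 1 \<Longrightarrow> cdual_apply g e = 1 \<Longrightarrow> g = f"
    and \<epsilon>: "\<epsilon> > 0"
  shows "\<forall>\<^sub>F n in sequentially. 3 ^ n * (norm (e + (1 / 3 ^ n) *\<^sub>R b) - 1) \<le> Re (cdual_apply f b) + \<epsilon>"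
proof -
  let ?p = "directional norm e"
  obtain g where g: "linear g" "\<And>v. g v \<le> ?p v" "g b = ?p b"
    using Hahn_Banach_touching[OF directional_sublinear[OF sublinear_norm]] by blast
  have gn: "g v \<le> norm v" for v
    using g(2)[of v] directional_le[OF sublinear_norm, of 0 e v] by simp
  obtain F :: "'a cdual" where F: "norm F \<le> 1" "\<And>v. Re (cdual_apply F v) = g v"
    using cdual_of_real_functional[OF g(1) gn] by metis
  have "g (- e) \<le> - 1" using g(2)[of "- e"] directional_self[OF sublinear_norm, of e] e by simp
  then have "Re (cdual_apply F e) \<ge> 1" using F(2) linear_neg[OF g(1), of e] by simp
  moreover have "cmod (cdual_apply F e) \<le> 1" using cdual_bound[of F e] F(1) e by simp
  ultimately have "cdual_apply F e = 1" using eq_of_real_if_Re_ge[of 1] by simp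
  then have "F = f" by (intro uniq F)
  then have "?p b < Re (cdual_apply f b) + \<epsilon>" using g(3) F(2)[of b] \<epsilon> by simp
  then obtain t where t: "t \<ge> 0" "norm (b + t *\<^sub>R e) - t * norm e < Re (cdual_apply f b) + \<epsilon>"
    using directional_approx[OF sublinear_norm] by metis
  have "\<forall>\<^sub>F n in sequentially. t \<le> 3 ^ n"
  proof -
    obtain n0 where n0: "t < 3 ^ n0" using real_arch_pow[of 3 t] by auto
    have "t \<le> 3 ^ n" if "n \<ge> n0" for n
    proof -
      have "(3::real) ^ n0 \<le> 3 ^ n" using that by (intro power_increasing) auto
      then show ?thesis using n0 by linarith
    qed
    then show ?thesis by (auto simp: eventually_sequentially)
  qed
  then show ?thesis
  proof eventually_elim
    case (elim n)
    have "3 ^ n * norm (e + (1 / 3 ^ n) *\<^sub>R b) = norm ((3 ^ n) *\<^sub>R (e + (1 / 3 ^ n) *\<^sub>R b))" by simp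
    also have "(3 ^ n) *\<^sub>R (e + (1 / 3 ^ n) *\<^sub>R b) = (b + t *\<^sub>R e) + (3 ^ n - t) *\<^sub>R e"
      by (simp add: algebra_simps)
    also have "norm \<dots> \<le> norm (b + t *\<^sub>R e) + (3 ^ n - t)"
      using norm_triangle_ineq[of "b + t *\<^sub>R e" "(3 ^ n - t) *\<^sub>R e"] elim e by simp
    finally show ?case using t(2) e by (simp add: right_diff_distrib)
  qed
qed

lemma Re_le_0_of_quadratic:
  fixes e k :: "'a::complex_normed_vector"
  assumes f: "norm f \<le> 1" "cdual_apply f e = 1"
    and le: "\<And>s. 0 < s \<Longrightarrow> s \<le> s0 \<Longrightarrow> norm (e + s *\<^sub>R k) \<le> 1 + C * s\<^sup>2" and s0: "s0 > 0"
  shows "Re (cdual_apply f k) \<le> 0"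
proof (rule field_le_epsilon)
  fix \<epsilon> :: real assume \<epsilon>: "\<epsilon> > 0"
  define s where "s = min s0 (\<epsilon> / (\<bar>C\<bar> + 1))"
  have s: "s > 0" "s \<le> s0" "s \<le> \<epsilon> / (\<bar>C\<bar> + 1)" using s0 \<epsilon> by (simp_all add: s_def)
  have "Re (cdual_apply f (e + s *\<^sub>R k)) \<le> norm (e + s *\<^sub>R k)"
    using complex_Re_le_cmod[of "cdual_apply f (e + s *\<^sub>R k)"] cdual_bound[of f "e + s *\<^sub>R k"]
      mult_right_mono[OF f(1), of "norm (e + s *\<^sub>R k)"] by simp
  then have "s * Re (cdual_apply f k) \<le> C * s\<^sup>2"
    using le[OF s(1,2)] f(2) by (simp add: linear_add[OF linear_cdual_apply] linear_scale[OF linear_cdual_apply])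
  then have "s * Re (cdual_apply f k) \<le> s * (C * s)" by (simp add: power2_eq_square mult_ac)
  then have "Re (cdual_apply f k) \<le> C * s" using s(1) by simp
  also have "\<dots> \<le> (\<bar>C\<bar> + 1) * s" using s(1) by (intro mult_right_mono) auto
  also have "\<dots> \<le> \<epsilon>" using s(3) by (simp add: pos_le_divide_eq mult.commute)
  finally show "Re (cdual_apply f k) \<le> 0 + \<epsilon>" by simp
qed

lemma scaleR_3: "3 *\<^sub>R v = v + v + (v::'a::real_vector)"
  using scaleR_left_distrib[of 2 1 v] by (simp add: scaleR_2)

context jb_star_triple
begin

lemma triple_tendsto:
  assumes "(a \<longlongrightarrow> a0) F" "(b \<longlongrightarrow> b0) F" "(c \<longlongrightarrow> c0) F"
  shows "((\<lambda>n. triple (a n) (b n) (c n)) \<longlongrightarrow> triple a0 b0 c0) F"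
proof -
  have "isCont (\<lambda>(a, b, c). triple a b c) (a0, b0, c0)"
    using continuous by (simp add: continuous_on_eq_continuous_at)
  from isCont_tendsto_compose[OF this tendsto_Pair[OF assms(1) tendsto_Pair[OF assms(2,3)]]]
  show ?thesis by simp
qed

lemma cube_add:
  "triple (u + v) (u + v) (u + v) =
    triple u u u + (2 *\<^sub>R triple u u v + triple u v u) + (2 *\<^sub>R triple u v v + triple v u v) + triple v v v"
  using symmetric[of v u u] symmetric[of v v u]
  by (simp add: add_left add_middle add_right scaleR_2 algebra_simps)

end

locale jb_tripotent = jb_star_triple triple
  for triple :: "'a::complex_banach \<Rightarrow> 'a \<Rightarrow> 'a \<Rightarrow> 'a" +
  fixes e :: 'a
  assumes tripotent: "triple e e e = e" and norm_e: "norm e = 1"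
begin

abbreviation D :: "'a \<Rightarrow> 'a" where "D h \<equiv> triple e e h"
abbreviation Q :: "'a \<Rightarrow> 'a" where "Q h \<equiv> triple e h e"

text \<open>
  The Peirce relations. They give \<open>D (2 D - 1) (D - 1) = 0\<close>, so that \<open>2 D\<^sup>2 - D\<close>, \<open>4 (D - D\<^sup>2)\<close> and
  \<open>1 - 3 D + 2 D\<^sup>2\<close> are the projections onto the eigenspaces of \<open>D\<close> for \<open>1\<close>, \<open>1/2\<close> and \<open>0\<close>.
\<close>

lemma D_Q: "D (Q h) = Q h" and Q_D: "Q (D h) = Q h"
proof -
  have 1: "D (Q h) = 2 *\<^sub>R Q h - Q (D h)"
    using jordan_identity[of e e e h e] by (simp add: tripotent scaleR_2)
  have 2: "Q h = 2 *\<^sub>R D (Q h) - Q (D h)"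
    using jordan_identity[of e h e e e] symmetric[of "Q h" e e] symmetric[of h e e]
    by (simp add: tripotent scaleR_2 algebra_simps)
  have "3 *\<^sub>R D (Q h) = D (Q h) + (2 *\<^sub>R D (Q h) - Q (D h)) + Q (D h)"
    by (simp add: scaleR_2 scaleR_3)
  also have "\<dots> = D (Q h) + Q h + Q (D h)" using 2 by simp
  also have "\<dots> = 3 *\<^sub>R Q h" using 1 by (simp add: scaleR_2 scaleR_3)
  finally have "3 *\<^sub>R D (Q h) = 3 *\<^sub>R Q h" .
  then show DQ: "D (Q h) = Q h" by simp
  show "Q (D h) = Q h" using 1 DQ by (simp add: scaleR_2)
qed

lemma Q_Q: "Q (Q h) = 2 *\<^sub>R D (D h) - D h"
  using jordan_identity[of h e e e e] symmetric[of h e e] symmetric[of "D h" e e]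
  by (simp add: tripotent scaleR_2 algebra_simps)

lemma D_cubic: "2 *\<^sub>R D (D (D h)) = 3 *\<^sub>R D (D h) - D h"
proof -
  have "D (2 *\<^sub>R D (D h) - D h) = 2 *\<^sub>R D (D h) - D h" using D_Q[of "Q h"] by (simp only: Q_Q)
  then have "2 *\<^sub>R D (D (D h)) - D (D h) = 2 *\<^sub>R D (D h) - D h"
    by (simp add: diff_right scaleR_right)
  then show ?thesis by (simp add: algebra_simps scaleR_2 scaleR_3)
qed

text \<open>
  The mixed terms \<open>{v, e, v}\<close> and \<open>{e, v, v}\<close> vanish: the first would be an eigenvector of \<open>D\<close> for
  \<open>- 1\<close>, the second one for both \<open>0\<close> and \<open>1\<close>.
\<close>

lemma orthogonal:
  assumes v: "D v = 0"
  shows cube_orthogonal: "triple (e + v) (e + v) (e + v) = e + triple v v v"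
    and D_cube: "D (triple v v v) = 0"
proof -
  have Q: "Q v = 0" using Q_D[of v] v by (simp add: zero_middle)
  have v': "triple v e e = 0" using v symmetric by simp
  have "D (triple v e v) = - triple v e v"
    using jordan_identity[of e e v e v] by (simp add: v tripotent zero_left zero_right)
  moreover define k where "k = triple v e v"
  ultimately have k: "D k = - k" by simp
  then have "2 *\<^sub>R (- k) = 3 *\<^sub>R k - (- k)" using D_cubic[of k] by (simp add: minus_right)
  moreover have "3 *\<^sub>R k - (- k) = 4 *\<^sub>R k" using scaleR_left_distrib[of 3 1 k] by simp
  ultimately have "(- 2) *\<^sub>R k = 4 *\<^sub>R k" by simp
  then have "k = 0" using scaleR_cancel_right[of "- 2" k 4] by simp
  then have k0: "triple v e v = 0" by (simp add: k_def)
  have "D (triple e v v) = 0"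
    using jordan_identity[of e v e e v] by (simp add: v v' Q zero_left zero_middle zero_right)
  moreover have "D (triple e v v) = triple e v v"
    using jordan_identity[of e e e v v] by (simp add: v tripotent zero_middle zero_right)
  ultimately have l0: "triple e v v = 0" by simp
  show "triple (e + v) (e + v) (e + v) = e + triple v v v"
    unfolding cube_add by (simp add: tripotent v Q k0 l0)
  show "D (triple v v v) = 0"
    using jordan_identity[of e e v v v] by (simp add: v zero_left zero_middle zero_right)
qed

abbreviation cube :: "'a \<Rightarrow> 'a" where "cube v \<equiv> triple v v v"

lemma iterated_cube_orthogonal:
  assumes v: "D v = 0"
  shows "(cube ^^ n) (e + v) = e + (cube ^^ n) v \<and> D ((cube ^^ n) v) = 0"
proof (induction n)
  case 0
  then show ?case using v by simp
next
  case (Suc n)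
  then show ?case using cube_orthogonal[of "(cube ^^ n) v"] D_cube[of "(cube ^^ n) v"] by simp
qed

lemma norm_iterated_cube: "norm ((cube ^^ n) v) = norm v ^ (3 ^ n)"
  by (induction n) (simp_all add: norm_cube power_mult[symmetric] mult.commute)

lemma norm_add_orthogonal:
  assumes v: "D v = 0" "norm v \<le> 1"
  shows "norm (e + v) \<le> 1"
proof (rule le_if_cubic_powers_le[where K = 2])
  fix k
  have "norm (e + v) ^ 3 ^ k = norm (e + (cube ^^ k) v)"
    using iterated_cube_orthogonal[OF v(1), of k] norm_iterated_cube[of k "e + v"] by simp
  also have "\<dots> \<le> 1 + norm v ^ 3 ^ k"
    using norm_triangle_ineq[of e "(cube ^^ k) v"] by (simp add: norm_e norm_iterated_cube)
  also have "\<dots> \<le> 2" using v(2) by (simp add: power_le_one)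
  finally show "norm (e + v) ^ 3 ^ k \<le> 2 * 1 ^ 3 ^ k" by simp
qed simp_all

lemma cube_expansion:
  assumes M: "\<And>a b c. norm (triple a b c) \<le> M * norm a * norm b * norm c" "M \<ge> 0"
    and h: "norm h \<le> 1"
  shows "\<bar>norm (e + h) ^ 3 - norm (e + (2 *\<^sub>R D h + Q h))\<bar> \<le> 4 * M * (norm h)\<^sup>2"
proof -
  have "norm (2 *\<^sub>R triple e h h + triple h e h + triple h h h)
      \<le> norm (2 *\<^sub>R triple e h h) + norm (triple h e h) + norm (triple h h h)"
    by (meson add_mono norm_triangle_ineq norm_triangle_le order_refl)
  also have "\<dots> \<le> 2 * (M * (norm h)\<^sup>2) + M * (norm h)\<^sup>2 + M * (norm h)\<^sup>2"
  proof (intro add_mono)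
    show "norm (2 *\<^sub>R triple e h h) \<le> 2 * (M * (norm h)\<^sup>2)"
      using M(1)[of e h h] by (simp add: norm_e power2_eq_square mult.assoc)
    show "norm (triple h e h) \<le> M * (norm h)\<^sup>2"
      using M(1)[of h e h] by (simp add: norm_e power2_eq_square mult.assoc)
    have "norm (triple h h h) \<le> M * (norm h)\<^sup>2 * norm h"
      using M(1)[of h h h] by (simp add: power2_eq_square mult.assoc)
    also have "\<dots> \<le> M * (norm h)\<^sup>2 * 1" using h M(2) by (intro mult_left_mono) auto
    finally show "norm (triple h h h) \<le> M * (norm h)\<^sup>2" by simp
  qed
  finally have r: "norm (2 *\<^sub>R triple e h h + triple h e h + triple h h h) \<le> 4 * M * (norm h)\<^sup>2" by simp
  have "norm (e + h) ^ 3 = norm ((e + (2 *\<^sub>R D h + Q h)) + (2 *\<^sub>R triple e h h + triple h e h + triple h h h))"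
    unfolding norm_cube[symmetric] cube_add tripotent by (simp only: add.assoc)
  then show ?thesis
    using r norm_triangle_ineq3[of "(e + (2 *\<^sub>R D h + Q h)) + (2 *\<^sub>R triple e h h + triple h e h + triple h h h)"
        "e + (2 *\<^sub>R D h + Q h)"] by simp
qed

text \<open>
  Here the cube of \<open>e + h\<close> is \<open>e + h\<close> up to second order, so that \<open>n = \<parallel>e + h\<parallel>\<close> satisfies
  \<open>n\<^sup>3 - n = O(\<parallel>h\<parallel>\<^sup>2)\<close>.
\<close>

lemma norm_add_le_of_derivative_1:
  assumes M: "\<And>a b c. norm (triple a b c) \<le> M * norm a * norm b * norm c" "M \<ge> 0"
    and h: "norm h \<le> 1" "2 *\<^sub>R D h + Q h = h"
  shows "norm (e + h) \<le> 1 + 4 * M * (norm h)\<^sup>2"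
proof (cases "norm (e + h) \<le> 1")
  case True
  moreover have "0 \<le> 4 * M * (norm h)\<^sup>2" using M(2) by simp
  ultimately show ?thesis by linarith
next
  case False
  define n where "n = norm (e + h)"
  have n: "n > 1" using False by (simp add: n_def)
  have "n ^ 3 \<le> n + 4 * M * (norm h)\<^sup>2"
    using cube_expansion[OF M h(1)] by (simp add: h(2) n_def)
  moreover have "n - 1 \<le> n ^ 3 - n"
  proof -
    have "(n - 1) * 1 \<le> (n - 1) * (n * (n + 1))"
      using n mult_mono[of 1 n 1 "n + 1"] by (intro mult_left_mono) auto
    then show ?thesis by (simp add: power3_eq_cube algebra_simps)
  qed
  ultimately show ?thesis by (simp add: n_def)
qed

lemma norm_add_le_of_derivative_0:
  assumes M: "\<And>a b c. norm (triple a b c) \<le> M * norm a * norm b * norm c" "M \<ge> 0"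
    and h: "norm h \<le> 1" "2 *\<^sub>R D h + Q h = 0"
  shows "norm (e + h) \<le> 1 + 4 * M * (norm h)\<^sup>2"
proof (cases "norm (e + h) \<le> 1")
  case True
  moreover have "0 \<le> 4 * M * (norm h)\<^sup>2" using M(2) by simp
  ultimately show ?thesis by linarith
next
  case False
  then have "norm (e + h) ^ 1 \<le> norm (e + h) ^ 3" by (intro power_increasing) auto
  then show ?thesis using cube_expansion[OF M h(1)] by (simp add: h(2) norm_e)
qed

text \<open>
  With \<open>\<eta> t = \<parallel>e + t b\<parallel> - 1\<close> the cube identity gives \<open>\<eta> (3 t) \<le> 3 \<eta> t + O(t\<^sup>2)\<close>: passing from scale \<open>t\<close>
  to scale \<open>3 t\<close> increases the difference quotient by \<open>O(t)\<close> at most. These increments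
  over \<open>t = 1/3, 1/9, \<dots>\<close> form a geometric series, so the quotient at scale \<open>1\<close> exceeds its limit at
  infinitesimal scales by \<open>O(\<parallel>b\<parallel>\<^sup>2)\<close> at most.
\<close>

lemma norm_add_le_of_derivative_3:
  assumes M: "\<And>a b c. norm (triple a b c) \<le> M * norm a * norm b * norm c" "M \<ge> 0"
    and b: "norm b \<le> 1" "2 *\<^sub>R D b + Q b = 3 *\<^sub>R b"
    and a: "\<And>\<epsilon>. \<epsilon> > 0 \<Longrightarrow> \<forall>\<^sub>F n in sequentially. 3 ^ n * (norm (e + (1 / 3 ^ n) *\<^sub>R b) - 1) \<le> a + \<epsilon>"
  shows "norm (e + b) \<le> 1 + a + (4 + 4 * M) * (norm b)\<^sup>2"
proof -
  define K where "K = (4 + 4 * M) * (norm b)\<^sup>2"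
  have K: "K \<ge> 0" using M(2) by (simp add: K_def)
  define \<eta> where "\<eta> t = norm (e + t *\<^sub>R b) - 1" for t
  have step: "\<eta> (3 * t) \<le> 3 * \<eta> t + K * t\<^sup>2" if t: "0 \<le> t" "t \<le> 1" for t
  proof -
    define u where "u = \<eta> t"
    have tb: "norm (t *\<^sub>R b) \<le> 1" using t b(1) by (simp add: mult_le_one)
    have u: "\<bar>u\<bar> \<le> t * norm b"
      using norm_triangle_ineq3[of "e + t *\<^sub>R b" e] t by (simp add: u_def \<eta>_def norm_e)
    then have u1: "\<bar>u\<bar> \<le> 1" using tb t by simp
    have u2: "u\<^sup>2 \<le> t\<^sup>2 * (norm b)\<^sup>2"
      using power_mono[OF u, of 2] by (simp add: power_mult_distrib)
    have "2 *\<^sub>R D (t *\<^sub>R b) + Q (t *\<^sub>R b) = t *\<^sub>R (2 *\<^sub>R D b + Q b)"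
      by (simp add: scaleR_right scaleR_middle scaleR_add_right)
    also have "\<dots> = (3 * t) *\<^sub>R b" unfolding b(2) by simp
    finally have "norm (e + (3 * t) *\<^sub>R b) \<le> norm (e + t *\<^sub>R b) ^ 3 + 4 * M * (norm (t *\<^sub>R b))\<^sup>2"
      using cube_expansion[OF M tb] by simp
    then have "\<eta> (3 * t) \<le> (1 + u) ^ 3 - 1 + 4 * M * (t\<^sup>2 * (norm b)\<^sup>2)"
      by (simp add: \<eta>_def u_def power_mult_distrib)
    also have "(1 + u) ^ 3 - 1 = 3 * u + 3 * u\<^sup>2 + u * u\<^sup>2"
      by (simp add: power3_eq_cube power2_eq_square algebra_simps)
    also have "u * u\<^sup>2 \<le> 1 * u\<^sup>2" using u1 by (intro mult_right_mono) auto
    finally have "\<eta> (3 * t) \<le> 3 * u + 4 * (t\<^sup>2 * (norm b)\<^sup>2) + 4 * M * (t\<^sup>2 * (norm b)\<^sup>2)"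
      using u2 by linarith
    then show ?thesis by (simp add: K_def u_def algebra_simps)
  qed
  have iter: "\<eta> 1 \<le> 3 ^ n * \<eta> (1 / 3 ^ n) + K * (1 - 1 / 3 ^ n) / 6" for n
  proof (induction n)
    case (Suc n)
    define s :: real where "s = 1 / 3 ^ Suc n"
    have s: "0 \<le> s" "s \<le> 1" "1 / 3 ^ n = 3 * s" "3 ^ n * s = 1 / 3"
      by (simp_all add: s_def del: power_Suc) (simp_all add: field_simps one_le_power)
    have "3 ^ n * \<eta> (3 * s) \<le> 3 ^ n * (3 * \<eta> s + K * s\<^sup>2)"
      using step[OF s(1,2)] by (intro mult_left_mono) auto
    also have "\<dots> = 3 ^ Suc n * \<eta> s + K * s * (3 ^ n * s)" by (simp add: power2_eq_square algebra_simps)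
    also have "\<dots> = 3 ^ Suc n * \<eta> s + K * s / 3" unfolding s(4) by simp
    finally have "\<eta> 1 \<le> 3 ^ Suc n * \<eta> s + K * s / 3 + K * (1 - 3 * s) / 6"
      using Suc unfolding s(3) by linarith
    moreover have "K * s / 3 + K * (1 - 3 * s) / 6 = K * (1 - s) / 6" by (simp add: field_simps)
    ultimately show ?case unfolding s_def[symmetric] by linarith
  qed simp
  have "\<eta> 1 \<le> a + K"
  proof (rule field_le_epsilon)
    fix \<epsilon> :: real assume "\<epsilon> > 0"
    from eventually_happens'[OF sequentially_bot a[OF this]]
    obtain n where n: "3 ^ n * \<eta> (1 / 3 ^ n) \<le> a + \<epsilon>" unfolding \<eta>_def by blast
    have "K * (1 - 1 / 3 ^ n) \<le> K * 1" using K by (intro mult_left_mono) auto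
    then have "K * (1 - 1 / 3 ^ n) / 6 \<le> K" using K by simp
    then show "\<eta> 1 \<le> a + K + \<epsilon>" using iter[of n] n by linarith
  qed
  then show ?thesis by (simp add: \<eta>_def K_def)
qed

text \<open>
  A vector \<open>h\<close> is split into its Peirce components, the first of them further into the parts \<open>b\<close>
  and \<open>c\<close> on which the conjugate linear map \<open>Q\<close> is \<open>1\<close> and \<open>- 1\<close>. The derivative of the cube map is
  \<open>3\<close> on \<open>b\<close>, \<open>1\<close> on \<open>c\<close> and \<open>h1\<close>, and \<open>0\<close> on \<open>h0\<close>. Convexity puts the four estimates together.
\<close>

lemma quadratic_smoothness:
  assumes f: "norm f \<le> 1" "cdual_apply f e = 1"
    and uniq: "\<And>g. norm g \<le> 1 \<Longrightarrow> cdual_apply g e = 1 \<Longrightarrow> g = f"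
  shows "\<exists>C\<ge>0. \<exists>\<delta>>0. \<forall>h. norm h \<le> \<delta> \<longrightarrow> norm (e + h) \<le> 1 + Re (cdual_apply f h) + C * (norm h)\<^sup>2"
proof -
  obtain M where M1: "M \<ge> 1" and M: "\<And>a b c. norm (triple a b c) \<le> M * norm a * norm b * norm c"
    using triple_bounded by blast
  have M0: "M \<ge> 0" using M1 by simp
  \<comment> \<open>\<open>L\<close> bounds the projections below; the factor \<open>4\<close> comes from averaging four components\<close>
  define L where "L = 8 * M\<^sup>2"
  define C where "C = 16 * (4 + 4 * M) * L\<^sup>2"
  define \<delta> where "\<delta> = 1 / (4 * L)"
  have MM: "1 \<le> M\<^sup>2" "M \<le> M\<^sup>2" using M1 power_increasing[of 1 2 M] by simp_all
  have L: "L \<ge> 1" using MM by (simp add: L_def)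
  have normD: "norm (D h) \<le> M * norm h" and normQ: "norm (Q h) \<le> M * norm h" for h
    using M[of e e h] M[of e h e] by (simp_all add: norm_e)
  have normDD: "norm (D (D h)) \<le> M\<^sup>2 * norm h" for h
    using normD[of "D h"] mult_left_mono[OF normD[of h] M0] by (simp add: power2_eq_square mult.assoc)
  have "norm (e + h) \<le> 1 + Re (cdual_apply f h) + C * (norm h)\<^sup>2" if h: "norm h \<le> \<delta>" for h
  proof -
    define p2 where "p2 = 2 *\<^sub>R D (D h) - D h"
    define b where "b = (1 / 2) *\<^sub>R (p2 + Q h)"
    define c where "c = (1 / 2) *\<^sub>R (p2 - Q h)"
    define h1 where "h1 = 4 *\<^sub>R (D h - D (D h))"
    define h0 where "h0 = h - 3 *\<^sub>R D h + 2 *\<^sub>R D (D h)"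
    have "p2 = Q (Q h)" by (simp add: p2_def Q_Q)
    then have Dp2: "D p2 = p2" and Qp2: "Q p2 = Q h"
      using D_Q[of "Q h"] Q_Q[of "Q h"] D_Q[of h] by (simp_all add: scaleR_2)
    have Qp2': "Q (Q h) = p2" by (simp add: p2_def Q_Q)
    have "b + c = p2"
      unfolding b_def c_def by (simp flip: scaleR_add_right)
    moreover have "p2 + h1 + h0 = h"
      using scaleR_left_distrib[of 2 2 "D h"] scaleR_left_distrib[of 2 2 "D (D h)"]
      by (simp add: p2_def h1_def h0_def scaleR_2 scaleR_3 scaleR_diff_right)
    ultimately have sum: "b + c + h1 + h0 = h" by simp
    have "D b = b" "Q b = b" "D c = c" "Q c = - c"
      by (simp_all add: b_def c_def add_right diff_right scaleR_right add_middle diff_middle scaleR_middle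
          Dp2 Qp2 Qp2' D_Q add.commute scaleR_diff_right)
    then have Db: "2 *\<^sub>R D b + Q b = 3 *\<^sub>R b" and Dc: "2 *\<^sub>R D c + Q c = c"
      by (simp_all add: scaleR_2 scaleR_3)
    have D3: "D (D (D h)) + D (D (D h)) = D (D h) + D (D h) + D (D h) - D h"
      using D_cubic[of h] by (simp add: scaleR_2 scaleR_3)
    have Q1: "Q h1 = 0" by (simp add: h1_def scaleR_middle diff_middle Q_D)
    have "2 *\<^sub>R D h1 = 4 *\<^sub>R (2 *\<^sub>R (D (D h) - D (D (D h))))"
      by (simp add: h1_def scaleR_right diff_right)
    also have "2 *\<^sub>R (D (D h) - D (D (D h))) = D (D h) + D (D h) - (D (D (D h)) + D (D (D h)))"
      by (simp add: scaleR_2)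
    finally have "2 *\<^sub>R D h1 = h1" unfolding D3 by (simp add: h1_def)
    then have D1: "2 *\<^sub>R D h1 + Q h1 = h1" by (simp add: Q1)
    have Q0: "Q h0 = 0" by (simp add: h0_def scaleR_middle diff_middle add_middle Q_D scaleR_2 scaleR_3)
    have "D h0 = D h - (D (D h) + D (D h) + D (D h)) + (D (D (D h)) + D (D (D h)))"
      by (simp add: h0_def scaleR_right diff_right add_right scaleR_2 scaleR_3)
    then have D0: "2 *\<^sub>R D h0 + Q h0 = 0" unfolding D3 by (simp add: Q0)
    define B where "B = M\<^sup>2 * norm h"
    have B: "0 \<le> B" "L * norm h = 8 * B" by (simp_all add: B_def L_def)
    have nDD: "norm (D (D h)) \<le> B" and nD: "norm (D h) \<le> B"
      and nQ: "norm (Q h) \<le> B" and nh: "norm h \<le> B"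
      using normDD[of h] normD[of h] normQ[of h] mult_right_mono[OF MM(2), of "norm h"]
        mult_right_mono[OF MM(1), of "norm h"] by (simp_all add: B_def)
    have np2: "norm p2 \<le> 3 * B"
      using norm_triangle_ineq4[of "2 *\<^sub>R D (D h)" "D h"] nDD nD by (simp add: p2_def)
    have nb: "norm b \<le> L * norm h"
      using norm_triangle_ineq[of p2 "Q h"] np2 nQ B by (simp add: b_def)
    have nc: "norm c \<le> L * norm h"
      using norm_triangle_ineq4[of p2 "Q h"] np2 nQ B by (simp add: c_def)
    have n1: "norm h1 \<le> L * norm h"
      using norm_triangle_ineq4[of "D h" "D (D h)"] nDD nD B by (simp add: h1_def)
    have n0: "norm h0 \<le> L * norm h"
      using norm_triangle_ineq4[of h "3 *\<^sub>R D h"] norm_triangle_ineq[of "h - 3 *\<^sub>R D h" "2 *\<^sub>R D (D h)"]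
        nDD nD nh B by (simp add: h0_def)
    have small: "norm (4 *\<^sub>R k) \<le> 1" if "norm k \<le> L * norm h" for k :: 'a
    proof -
      have "L * norm h \<le> L * \<delta>" using h L by (intro mult_left_mono) auto
      also have "\<dots> = 1 / 4" using L by (simp add: \<delta>_def)
      finally show ?thesis using that by simp
    qed
    have scaled: "2 *\<^sub>R D (s *\<^sub>R k) + Q (s *\<^sub>R k) = r *\<^sub>R (s *\<^sub>R k)" if "2 *\<^sub>R D k + Q k = r *\<^sub>R k" for r s :: real and k
    proof -
      have "2 *\<^sub>R D (s *\<^sub>R k) + Q (s *\<^sub>R k) = s *\<^sub>R (2 *\<^sub>R D k + Q k)"
        by (simp add: scaleR_right scaleR_middle scaleR_add_right)
      then show ?thesis unfolding that by (simp add: mult.commute)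
    qed
    have quad: "4 * M * (norm (4 *\<^sub>R k))\<^sup>2 \<le> C * (norm h)\<^sup>2" "(4 + 4 * M) * (norm (4 *\<^sub>R k))\<^sup>2 \<le> C * (norm h)\<^sup>2"
      if k: "norm k \<le> L * norm h" for k :: 'a
    proof -
      have "(norm (4 *\<^sub>R k))\<^sup>2 \<le> 16 * L\<^sup>2 * (norm h)\<^sup>2"
        using power_mono[OF k, of 2] by (simp add: power_mult_distrib)
      then have "(4 + 4 * M) * (norm (4 *\<^sub>R k))\<^sup>2 \<le> (4 + 4 * M) * (16 * L\<^sup>2 * (norm h)\<^sup>2)"
        using M0 by (intro mult_left_mono) auto
      also have "\<dots> = C * (norm h)\<^sup>2" unfolding C_def by (simp only: mult_ac)
      finally show *: "(4 + 4 * M) * (norm (4 *\<^sub>R k))\<^sup>2 \<le> C * (norm h)\<^sup>2" .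
      have "4 * M * (norm (4 *\<^sub>R k))\<^sup>2 \<le> (4 + 4 * M) * (norm (4 *\<^sub>R k))\<^sup>2" by (intro mult_right_mono) auto
      then show "4 * M * (norm (4 *\<^sub>R k))\<^sup>2 \<le> C * (norm h)\<^sup>2" using * by linarith
    qed
    \<comment> \<open>the norm grows only quadratically along \<open>- k\<close>, so \<open>f\<close> cannot be positive at \<open>- k\<close>\<close>
    have vanish: "Re (cdual_apply f k) \<ge> 0" if k: "2 *\<^sub>R D k + Q k = r *\<^sub>R k" "r = 1 \<or> r = 0" for k r
    proof -
      have "Re (cdual_apply f (- k)) \<le> 0"
      proof (rule Re_le_0_of_quadratic[OF f])
        fix s :: real assume s: "0 < s" "s \<le> 1 / (norm k + 1)"
        have "norm k * s \<le> (norm k + 1) * s" using s by (intro mult_right_mono) auto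
        also have "\<dots> \<le> 1" using s by (simp add: pos_le_divide_eq add_pos_nonneg mult.commute add_nonneg_pos)
        finally have n: "norm ((- s) *\<^sub>R k) \<le> 1" using s by (simp add: mult.commute)
        have "norm (e + (- s) *\<^sub>R k) \<le> 1 + 4 * M * (norm ((- s) *\<^sub>R k))\<^sup>2"
          using k(2) scaled[OF k(1), of "- s"] norm_add_le_of_derivative_1[OF M M0 n]
            norm_add_le_of_derivative_0[OF M M0 n] by auto
        then show "norm (e + s *\<^sub>R (- k)) \<le> 1 + (4 * M * (norm k)\<^sup>2) * s\<^sup>2"
          by (simp add: power_mult_distrib mult_ac)
      qed (simp add: add_nonneg_pos)
      then show ?thesis by (simp add: linear_neg[OF linear_cdual_apply])
    qed
    have "0 \<le> Re (cdual_apply f c)" "0 \<le> Re (cdual_apply f h1)" "0 \<le> Re (cdual_apply f h0)"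
      using vanish[of c 1] vanish[of h1 1] vanish[of h0 0] Dc D1 D0 by simp_all
    then have fb: "Re (cdual_apply f b) \<le> Re (cdual_apply f h)"
      unfolding sum[symmetric] by (simp add: linear_add[OF linear_cdual_apply])
    have eb: "norm (e + 4 *\<^sub>R b) \<le> 1 + 4 * Re (cdual_apply f h) + C * (norm h)\<^sup>2"
    proof -
      have "norm (e + 4 *\<^sub>R b) \<le> 1 + Re (cdual_apply f (4 *\<^sub>R b)) + (4 + 4 * M) * (norm (4 *\<^sub>R b))\<^sup>2"
        by (rule norm_add_le_of_derivative_3[OF M M0 small[OF nb] scaled[OF Db]])
          (rule difference_quotient_le_of_unique_support[OF norm_e uniq])
      then show ?thesis using quad(2)[OF nb] fb by (simp add: linear_scale[OF linear_cdual_apply])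
    qed
    have ec: "norm (e + 4 *\<^sub>R c) \<le> 1 + C * (norm h)\<^sup>2"
      using norm_add_le_of_derivative_1[OF M M0 small[OF nc]] scaled[of c 1 4] Dc quad(1)[OF nc] by simp
    have e1: "norm (e + 4 *\<^sub>R h1) \<le> 1 + C * (norm h)\<^sup>2"
      using norm_add_le_of_derivative_1[OF M M0 small[OF n1]] scaled[of h1 1 4] D1 quad(1)[OF n1] by simp
    have e0: "norm (e + 4 *\<^sub>R h0) \<le> 1 + C * (norm h)\<^sup>2"
      using norm_add_le_of_derivative_0[OF M M0 small[OF n0]] scaled[of h0 0 4] D0 quad(1)[OF n0] by simp
    have "4 *\<^sub>R (e + h) = (e + 4 *\<^sub>R b) + (e + 4 *\<^sub>R c) + ((e + 4 *\<^sub>R h1) + (e + 4 *\<^sub>R h0))"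
      unfolding sum[symmetric] using scaleR_left_distrib[of 2 2 e]
      by (simp add: scaleR_add_right scaleR_2 add_ac)
    then have "4 * norm (e + h) = norm ((e + 4 *\<^sub>R b) + (e + 4 *\<^sub>R c) + ((e + 4 *\<^sub>R h1) + (e + 4 *\<^sub>R h0)))"
      by (metis norm_scaleR abs_numeral)
    also have "\<dots> \<le> (norm (e + 4 *\<^sub>R b) + norm (e + 4 *\<^sub>R c)) + (norm (e + 4 *\<^sub>R h1) + norm (e + 4 *\<^sub>R h0))"
      by (intro order_trans[OF norm_triangle_ineq] add_mono norm_triangle_ineq)
    finally show ?thesis using eb ec e1 e0 by linarith
  qed
  moreover have "C \<ge> 0" "\<delta> > 0" using M0 L by (simp_all add: C_def \<delta>_def)
  ultimately show ?thesis by blast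
qed

end

section \<open>Frechet differentiability at a very smooth point\<close>

context jb_unit_vector
begin

context
  fixes e :: 'a
  assumes lim: "odd_power \<longlonglongrightarrow> e"
begin

lemma tripotent_limit: "jb_tripotent triple e"
proof
  have "(\<lambda>n. triple (odd_power n) (odd_power n) (odd_power n)) \<longlonglongrightarrow> triple e e e" by (intro triple_tendsto lim)
  moreover have "(\<lambda>n. odd_power (n + n + n + 1)) \<longlonglongrightarrow> e"
    using lim by (rule LIMSEQ_subseq_LIMSEQ[unfolded comp_def]) (simp add: strict_mono_def)
  ultimately show "triple e e e = e" unfolding odd_power_triple by (rule LIMSEQ_unique)
  have "(\<lambda>n. norm (odd_power n)) \<longlonglongrightarrow> norm e" by (intro tendsto_norm lim)
  then show "norm e = 1" by (simp add: norm_odd_power LIMSEQ_const_iff)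
qed

lemma limit_orthogonal: "triple e e (x - e) = 0"
proof -
  have "(\<lambda>n. triple (odd_power n) (odd_power n) (odd_power 0)) \<longlonglongrightarrow> triple e e (odd_power 0)" by (intro triple_tendsto lim tendsto_const)
  moreover have "(\<lambda>n. odd_power (n + n + 0 + 1)) \<longlonglongrightarrow> e"
    using lim by (rule LIMSEQ_subseq_LIMSEQ[unfolded comp_def]) (simp add: strict_mono_def)
  ultimately have "triple e e (odd_power 0) = e" unfolding odd_power_triple by (rule LIMSEQ_unique)
  then show ?thesis
    using jb_tripotent.tripotent[OF tripotent_limit] by (simp add: diff_right odd_power_0)
qed

text \<open>
  The iterated cubes of \<open>x = e + (x - e)\<close> are odd powers of \<open>x\<close> and tend to \<open>e\<close>, so the iterated
  cubes of \<open>x - e\<close>, whose norms are \<open>\<parallel>x - e\<parallel>\<close> to the powers \<open>3\<^sup>n\<close>, tend to \<open>0\<close>.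
\<close>

lemma norm_remainder: "norm (x - e) < 1"
proof -
  interpret e: jb_tripotent triple e by (rule tripotent_limit)
  have "\<exists>m\<ge>n. (e.cube ^^ n) x = odd_power m" for n
  proof (induction n)
    case 0
    then show ?case by (auto intro!: exI[of _ 0] simp: odd_power_0)
  next
    case (Suc n)
    then obtain m where "m \<ge> n" "(e.cube ^^ n) x = odd_power m" by blast
    then show ?case by (intro exI[of _ "m + m + m + 1"]) (simp add: odd_power_triple)
  qed
  then obtain m where m: "\<And>n. m n \<ge> n" "\<And>n. (e.cube ^^ n) x = odd_power (m n)" by metis
  obtain n0 where n0: "\<And>n. n \<ge> n0 \<Longrightarrow> norm (odd_power n - e) < 1"
    using LIMSEQ_D[OF lim, of 1] by auto
  have "(e.cube ^^ n0) x = e + (e.cube ^^ n0) (x - e)"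
    using e.iterated_cube_orthogonal[OF limit_orthogonal, of n0] by simp
  then have "norm ((e.cube ^^ n0) (x - e)) < 1"
    using n0[OF m(1)[of n0]] m(2)[of n0] by (metis add_diff_cancel_left')
  then have "norm (x - e) ^ 3 ^ n0 < 1" by (simp add: e.norm_iterated_cube)
  then show ?thesis using one_le_power[of "norm (x - e)" "3 ^ n0"] by linarith
qed

end

text \<open>
  With \<open>w = x - e\<close> and \<open>\<parallel>w\<parallel> \<le> c < 1\<close>, both \<open>e - w\<close> and \<open>e + w / c\<close> lie in the unit ball by
  orthogonality. The first shows that support functionals of \<open>e\<close> support \<open>x\<close>; the second makes \<open>x\<close>
  the convex combination \<open>(1 - c) e + c (e + w / c)\<close>.
\<close>

theorem quadratic_smoothness_at_very_smooth_point:
  assumes vs: "very_smooth_point x" and f: "norm f \<le> 1" "cdual_apply f x = 1"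
  shows "\<exists>C\<ge>0. \<exists>\<delta>>0. \<forall>h. norm h \<le> \<delta> \<longrightarrow> norm (x + h) \<le> 1 + Re (cdual_apply f h) + C * (norm h)\<^sup>2"
proof -
  obtain e where lim: "odd_power \<longlonglongrightarrow> e" using powers_convergent[OF vs] by (auto simp: convergent_def)
  interpret e: jb_tripotent triple e by (rule tripotent_limit[OF lim])
  define w where "w = x - e"
  have w: "triple e e w = 0" "norm w < 1"
    using limit_orthogonal[OF lim] norm_remainder[OF lim] by (simp_all add: w_def)
  have x: "x = e + w" by (simp add: w_def)
  note lin = linear_add[OF linear_cdual_apply] linear_diff[OF linear_cdual_apply]
  have Re_le: "Re (cdual_apply F v) \<le> 1" if "norm F \<le> 1" "norm v \<le> 1" for F :: "'a cdual" and v
    using complex_Re_le_cmod[of "cdual_apply F v"] cdual_bound[of F v] mult_mono[OF that] by simp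
  have sup: "g = f" if g: "norm g \<le> 1" "cdual_apply g e = 1" for g
  proof -
    have "norm (e + - w) \<le> 1" using w by (intro e.norm_add_orthogonal) (simp_all add: minus_right)
    from Re_le[OF g(1) this] have "Re (cdual_apply g x) \<ge> 1" using g(2) by (simp add: x lin)
    moreover have "cmod (cdual_apply g x) \<le> 1" using cdual_bound[of g x] g(1) unit by simp
    ultimately have "cdual_apply g x = 1" using eq_of_real_if_Re_ge[of 1] by simp
    then show ?thesis by (intro very_smooth_unique_support[OF vs f g(1)])
  qed
  obtain g where "norm g \<le> 1" "cdual_apply g e = 1"
    using norming_functional[of e] e.norm_e by auto
  with sup have fe: "cdual_apply f e = 1" by blast
  obtain C d where C: "C \<ge> 0" "d > 0"
    "\<And>h. norm h \<le> d \<Longrightarrow> norm (e + h) \<le> 1 + Re (cdual_apply f h) + C * (norm h)\<^sup>2"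
    using e.quadratic_smoothness[OF f(1) fe sup] by blast
  define c where "c = max (norm w) (1 / 2)"
  have c: "0 < c" "c < 1" "norm w \<le> c" using w by (auto simp: c_def)
  have ew: "norm (e + (1 / c) *\<^sub>R w) \<le> 1"
    using c by (intro e.norm_add_orthogonal) (simp_all add: scaleR_right w)
  have "norm (x + h) \<le> 1 + Re (cdual_apply f h) + C / (1 - c) * (norm h)\<^sup>2" if h: "norm h \<le> d * (1 - c)" for h
  proof -
    define k where "k = (1 / (1 - c)) *\<^sub>R h"
    have kh: "h = (1 - c) *\<^sub>R k" using c by (simp add: k_def)
    have nk: "norm k \<le> d" using h c by (simp add: k_def pos_divide_le_eq)
    have "x + h = (1 - c) *\<^sub>R (e + k) + c *\<^sub>R (e + (1 / c) *\<^sub>R w)"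
      using c by (simp add: x kh algebra_simps)
    then have "norm (x + h) \<le> (1 - c) * norm (e + k) + c * norm (e + (1 / c) *\<^sub>R w)"
      using norm_triangle_ineq[of "(1 - c) *\<^sub>R (e + k)" "c *\<^sub>R (e + (1 / c) *\<^sub>R w)"] c by simp
    also have "\<dots> \<le> (1 - c) * (1 + Re (cdual_apply f k) + C * (norm k)\<^sup>2) + c * 1"
      using c ew C(3)[OF nk] by (intro add_mono mult_left_mono) auto
    also have "\<dots> = 1 + Re (cdual_apply f h) + C / (1 - c) * (norm h)\<^sup>2"
    proof -
      have "Re (cdual_apply f h) = (1 - c) * Re (cdual_apply f k)"
        unfolding kh linear_scale[OF linear_cdual_apply] by simp
      moreover have "C / (1 - c) * (norm h)\<^sup>2 = (1 - c) * (C * (norm k)\<^sup>2)"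
        using c by (simp only: kh norm_scaleR power_mult_distrib) (simp add: power2_eq_square)
      ultimately show ?thesis by (simp only: distrib_left) simp
    qed
    finally show ?thesis .
  qed
  moreover have "C / (1 - c) \<ge> 0" "d * (1 - c) > 0" using C c by simp_all
  ultimately show ?thesis by blast
qed

end

lemma has_derivative_norm_of_quadratic:
  fixes x :: "'a::complex_normed_vector"
  assumes x: "norm x = 1" and f: "norm f \<le> 1" "cdual_apply f x = 1" and C: "C \<ge> 0" "\<delta> > 0"
    and le: "\<And>h. norm h \<le> \<delta> \<Longrightarrow> norm (x + h) \<le> 1 + Re (cdual_apply f h) + C * (norm h)\<^sup>2"
  shows "(norm has_derivative (\<lambda>h. Re (cdual_apply f h))) (at x)"
  unfolding has_derivative_at_alt
proof (intro conjI allI impI)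
  show "bounded_linear (\<lambda>h. Re (cdual_apply f h))"
    by (rule bounded_linear_compose[OF bounded_linear_Re bounded_linear_cdual_apply])
next
  fix \<epsilon> :: real assume \<epsilon>: "\<epsilon> > 0"
  define d where "d = min \<delta> (\<epsilon> / (C + 1))"
  have d: "d > 0" "d \<le> \<delta>" "d \<le> \<epsilon> / (C + 1)" using C \<epsilon> by (simp_all add: d_def)
  show "\<exists>d>0. \<forall>y. norm (y - x) < d \<longrightarrow> norm (norm y - norm x - Re (cdual_apply f (y - x))) \<le> \<epsilon> * norm (y - x)"
  proof (intro exI[of _ d] conjI allI impI d(1))
    fix y assume y: "norm (y - x) < d"
    define h where "h = y - x"
    have yx: "y = x + h" by (simp add: h_def)
    have "Re (cdual_apply f (x + h)) \<le> norm (x + h)"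
      using complex_Re_le_cmod[of "cdual_apply f (x + h)"] cdual_bound[of f "x + h"]
        mult_right_mono[OF f(1), of "norm (x + h)"] by simp
    then have low: "0 \<le> norm y - norm x - Re (cdual_apply f h)"
      using f(2) by (simp add: yx x linear_add[OF linear_cdual_apply])
    have "norm h \<le> \<epsilon> / (C + 1)" using y d(3) by (simp add: h_def)
    then have "(C + 1) * norm h \<le> \<epsilon>" using C by (simp add: pos_le_divide_eq mult.commute)
    then have "C * norm h + norm h \<le> \<epsilon>" by (simp add: distrib_right)
    then have "C * norm h \<le> \<epsilon>" using norm_ge_zero[of h] by linarith
    then have "C * (norm h)\<^sup>2 \<le> \<epsilon> * norm h"
      using mult_right_mono[of "C * norm h" \<epsilon> "norm h"] by (simp add: power2_eq_square)
    moreover have "norm y \<le> 1 + Re (cdual_apply f h) + C * (norm h)\<^sup>2"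
      unfolding yx using y d(2) by (intro le) (simp add: h_def)
    ultimately show "norm (norm y - norm x - Re (cdual_apply f (y - x))) \<le> \<epsilon> * norm (y - x)"
      using low x unfolding h_def by simp
  qed
qed

theorem proposition18:
  fixes triple :: "'a::complex_banach \<Rightarrow> 'a \<Rightarrow> 'a \<Rightarrow> 'a" and x :: 'a
  assumes "jb_star_triple triple"
    and "very_smooth_point x"
  shows "frechet_smooth_point x"
proof -
  have x: "norm x = 1" using assms(2) by (simp add: very_smooth_point_def)
  interpret jb_unit_vector triple x
    by (rule jb_unit_vector.intro[OF assms(1)]) (unfold_locales, rule x)
  obtain f :: "'a cdual" where f: "norm f \<le> 1" "cdual_apply f x = 1"
    using norming_functional[of x] x by auto
  from quadratic_smoothness_at_very_smooth_point[OF assms(2) f]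
  have "(norm has_derivative (\<lambda>h. Re (cdual_apply f h))) (at x)"
    using has_derivative_norm_of_quadratic[OF x f] by blast
  then show ?thesis using x by (auto simp: frechet_smooth_point_def differentiable_def)
qed

end
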